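(* Let $\lambda_0,\mu_0\in\mathbb{R}$ satisfy $\mu_0>0$ and $3\lambda_0+2\mu_0>0$, and let $\Omega=\{x\in\mathbb{R}^3:|x|<1\}$. There exists $T_0>0$, depending only on $\lambda_0,\mu_0$, such that the following holds for every $T\ge T_0$. Let $\dot\rho\in C_c^\infty(\Omega)$ and let $\mathbf{\dot C}=(\dot c_{ijk\ell})_{1\le i,j,k,\ell\le 3}$ be a real tensor field with $\dot c_{ijk\ell}\in C_c^\infty(\Omega)$ and $\dot c_{ijk\ell}=\dot c_{jik\ell}=\dot c_{k\ell ij}$. For each pair $(i,j)\in\{1,2,3\}^2$, let $\mathcal{A}'[\mathbf{C}_0,1](\mathbf{\dot C},\dot\rho)(\cdot,\cdot;\mathbf{e}_i,\mathbf{e}_j)$ be the restriction to $\Omega^c\times(-\infty,T]$ of the linearized scattered wave $\dot u$ (defined in the context) generated by the incident wave with direction $\theta=\mathbf{e}_i$ and polarization $\alpha=\mathbf{e}_j$. If $$\mathcal{A}'[\mathbf{C}_0,1](\mathbf{\dot C},\dot\rho)(x,t;\mathbf{e}_i,\mathbf{e}_j)=0\quad\text{for }(x,t)\in\Omega^c\times(-\infty,T]\text{ and all } i,j=1,2,3,$$ then $\dot\rho=0$ and $\dot c_{ijk\ell}=0$ for all $i,j,k,\ell$.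
   Context: Repeated indices are summed over $1,2,3$. $\mathbf{e}_i$ is the unit vector in the positive $x_i$-direction, $\Omega^c=\mathbb{R}^3\setminus\Omega$, and $H_0$ is the Heaviside function on $\mathbb{R}$. Put $c_p=\sqrt{\lambda_0+2\mu_0}$ and $c_s=\sqrt{\mu_0}$ (so $c_p>c_s$). The background medium is isotropic and homogeneous with density $1$ and elastic tensor $\mathbf{C}_0=(\lambda_0\delta_{ij}\delta_{k\ell}+\mu_0(\delta_{ik}\delta_{j\ell}+\delta_{i\ell}\delta_{jk}))$. For $\theta,\alpha\in\mathbb{S}^2$ with $\alpha=\theta$ or $\alpha\perp\theta$, the incident plane wave $u_0=(u_{01},u_{02},u_{03})$ on $\mathbb{R}^3\times\mathbb{R}$ is - the $P$-wave $u_0(x,t)=\theta H_0(c_pt-\theta\cdot x)$ if $\alpha=\theta$; - the $S$-wave $u_0(x,t)=\alpha H_0(c_st-\theta\cdot x)$ if $\alpha\perp\theta$. The linearized (Born-approximation, single-)scattered wave $\dot u=(\dot u_1,\dot u_2,\dot u_3)$ is the unique distributional solution of $$\partial_t^2\dot u_i-(\lambda_0+\mu_0)\partial_i(\nabla\cdot\dot u)-\mu_0\Delta\dot u_i=\partial_j(\dot c_{ijk\ell}\,\partial_k u_{0\ell})-\dot\rho\,\partial_t^2u_{0i}\ \text{ in }\mathbb{R}^3\times\mathbb{R},\qquad \dot u=0\ \text{ for } t\ll 0,$$ and $\mathcal{A}'[\mathbf{C}_0,1](\mathbf{\dot C},\dot\rho)(\cdot,\cdot;\theta,\alpha):=\dot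 u|_{\Omega^c\times(-\infty,T]}$. *)

theory Defs
  imports "HOL-Analysis.Analysis"
begin

section \<open>Test functions\<close>

definition dderiv :: "'a::euclidean_space \<Rightarrow> ('a \<Rightarrow> real) \<Rightarrow> ('a \<Rightarrow> real)" where
  "dderiv v f = (\<lambda>x. frechet_derivative f (at x) v)"

text \<open>\<open>foldr dderiv [v1, \<dots>, vn] f\<close> is the iterated derivative of \<open>f\<close> along \<open>vn\<close>, \<dots>, \<open>v1\<close>.
  Differentiability of all iterated derivatives forces their continuity.\<close>

definition smooth :: "('a::euclidean_space \<Rightarrow> real) \<Rightarrow> bool" where
  "smooth f \<longleftrightarrow> (\<forall>vs x. foldr dderiv vs f differentiable (at x))"

definition fsupport :: "('a::topological_space \<Rightarrow> real) \<Rightarrow> 'a set" where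
  "fsupport f = closure {x. f x \<noteq> 0}"

text \<open>Functions on the whole space, so \<open>C\<^sub>c\<^sup>\<infinity>(A)\<close> for open \<open>A\<close> is identified with its extension
  by zero. The set \<open>A\<close> is not required to be open.\<close>

definition Cc_inf :: "'a::euclidean_space set \<Rightarrow> ('a \<Rightarrow> real) set" where
  "Cc_inf A = {f. smooth f \<and> compact (fsupport f) \<and> fsupport f \<subseteq> A}"


section \<open>Distributions\<close>

text \<open>A distribution is represented by a functional of which only the values on \<open>Cc_inf UNIV\<close>
  are meaningful; two distributions are equal if they agree there.\<close>

type_synonym 'a functional = "('a \<Rightarrow> real) \<Rightarrow> real"

text \<open>Continuity is expressed by the usual seminorm estimates on compact sets; the sum runs over
  all iterated partial derivatives of order at most \<open>N\<close>.\<close>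

definition distribution :: "('a::euclidean_space) functional \<Rightarrow> bool" where
  "distribution u \<longleftrightarrow>
     (\<forall>f\<in>Cc_inf UNIV. \<forall>g\<in>Cc_inf UNIV. \<forall>a b.
        u (\<lambda>x. a * f x + b * g x) = a * u f + b * u g) \<and>
     (\<forall>K. compact K \<longrightarrow> (\<exists>B N. \<forall>f\<in>Cc_inf K.
        \<bar>u f\<bar> \<le> B * (\<Sum>vs | set vs \<subseteq> Basis \<and> length vs \<le> N. SUP x. \<bar>foldr dderiv vs f x\<bar>)))"

definition dist_of :: "('a::euclidean_space \<Rightarrow> real) \<Rightarrow> 'a functional" where
  "dist_of g = (\<lambda>f. \<integral>x. g x * f x \<partial>lborel)"

definition dist_deriv :: "'a::euclidean_space \<Rightarrow> 'a functional \<Rightarrow> 'a functional" where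
  "dist_deriv v u = (\<lambda>f. - u (dderiv v f))"

definition dist_mult :: "('a::euclidean_space \<Rightarrow> real) \<Rightarrow> 'a functional \<Rightarrow> 'a functional" where
  "dist_mult g u = (\<lambda>f. u (\<lambda>x. g x * f x))"

text \<open>The restriction of \<open>u\<close> to \<open>A\<close>, i.e. to test functions supported in \<open>A\<close>, is zero. For open
  \<open>A\<close> this is the standard notion; for the closure of an open set it is the restriction in the
  sense of extendible distributions.\<close>

definition vanishes_on :: "('a::euclidean_space) functional \<Rightarrow> 'a set \<Rightarrow> bool" where
  "vanishes_on u A \<longleftrightarrow> (\<forall>f\<in>Cc_inf A. u f = 0)"


section \<open>Linearized elastic scattering\<close>

type_synonym spacetime = "(real^3) \<times> real"

abbreviation D_x :: "3 \<Rightarrow> spacetime functional \<Rightarrow> spacetime functional" where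
  "D_x k \<equiv> dist_deriv (axis k 1, 0)"

abbreviation D_t :: "spacetime functional \<Rightarrow> spacetime functional" where
  "D_t \<equiv> dist_deriv (0, 1)"

definition heaviside :: "real \<Rightarrow> real" where
  "heaviside s = (if s \<ge> 0 then 1 else 0)"

definition c_p :: "real \<Rightarrow> real \<Rightarrow> real" where
  "c_p lam mu = sqrt (lam + 2 * mu)"

definition c_s :: "real \<Rightarrow> real" where
  "c_s mu = sqrt mu"

text \<open>Meaningful for unit vectors \<open>\<theta>\<close>, \<open>\<alpha>\<close> with \<open>\<alpha> = \<theta>\<close> (P-wave) or \<open>\<alpha>\<close> orthogonal to \<open>\<theta>\<close>
  (S-wave).\<close>

definition incident_wave :: "real \<Rightarrow> real \<Rightarrow> real^3 \<Rightarrow> real^3 \<Rightarrow> spacetime \<Rightarrow> real^3" where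
  "incident_wave lam mu \<theta> \<alpha> = (\<lambda>(x, t).
     if \<alpha> = \<theta> then heaviside (c_p lam mu * t - \<theta> \<bullet> x) *\<^sub>R \<theta>
     else heaviside (c_s mu * t - \<theta> \<bullet> x) *\<^sub>R \<alpha>)"

text \<open>\<open>u\<close> is the scattered wave of the linearized problem around the isotropic medium with
  Lame parameters \<open>lam\<close>, \<open>mu\<close> and density 1. This is a relation, not a function: it holds for
  the unique distributional solution of the Cauchy problem and for nothing else (up to values
  outside \<open>Cc_inf UNIV\<close>).\<close>

definition linearized_scattered_wave ::
  "real \<Rightarrow> real \<Rightarrow> (3 \<Rightarrow> 3 \<Rightarrow> 3 \<Rightarrow> 3 \<Rightarrow> real^3 \<Rightarrow> real) \<Rightarrow> (real^3 \<Rightarrow> real) \<Rightarrow>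
   real^3 \<Rightarrow> real^3 \<Rightarrow> (3 \<Rightarrow> spacetime functional) \<Rightarrow> bool" where
  "linearized_scattered_wave lam mu C \<rho> \<theta> \<alpha> u \<longleftrightarrow>
     (let u\<^sub>0 = (\<lambda>l. dist_of (\<lambda>p. incident_wave lam mu \<theta> \<alpha> p $ l));
          divu = (\<lambda>f. \<Sum>j\<in>UNIV. D_x j (u j) f)
      in (\<forall>i. distribution (u i)) \<and>
         (\<forall>i. \<forall>f\<in>Cc_inf UNIV.
            D_t (D_t (u i)) f
              - (lam + mu) * D_x i divu f
              - mu * (\<Sum>j\<in>UNIV. D_x j (D_x j (u i)) f)
            = (\<Sum>j\<in>UNIV. \<Sum>k\<in>UNIV. \<Sum>l\<in>UNIV.
                 D_x j (dist_mult (\<lambda>(x, t). C i j k l x) (D_x k (u\<^sub>0 l))) f)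
              - dist_mult (\<lambda>(x, t). \<rho> x) (D_t (D_t (u\<^sub>0 i))) f) \<and>
         (\<exists>t\<^sub>0. \<forall>i. vanishes_on (u i) (UNIV \<times> {..<t\<^sub>0})))"

end

theory Submission
  imports Defs
begin

text \<open>
The equation is paired with elastic plane waves, and the resulting identities are read as linear
equations for the Laplace transforms of the coefficients, one linear system for each frequency.

\<^bold>\<open>Pairing with plane waves.\<close> Let \<open>v = \<beta> \<phi>(c' t - \<omega> \<bullet> x)\<close> be a plane wave of the background medium whose
profile \<open>\<phi>\<close> has compact support, and let \<open>F\<close> be this wave cut off in space outside the unit ball.
The elastic operator maps \<open>F\<close> to a function that vanishes in the ball and is supported in times at
most \<open>T\<close>, as soon as the wave has left the ball of radius 2 by time \<open>T\<close>. There the scattered wave is zero,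
so the source is orthogonal to \<open>v\<close> (\<open>elastic_adjoint_vanishing\<close>). The incident wave is the
Heaviside function of its phase, so the pairing with the source is an integral over the front
\<open>c t = \<theta> \<bullet> x\<close>. With \<open>\<phi>' = exp (\<kappa> s)\<close> on the relevant range of phases, it becomes
\<open>\<hat>C(\<beta>, \<omega>, \<theta>, \<alpha>) = c c' (\<alpha> \<bullet> \<beta>) \<hat>\<rho>\<close>, where the hats are Laplace transforms at the frequency
\<open>\<xi> = \<kappa> ((c' / c) \<theta> - \<omega>)\<close> (\<open>scattering_identity\<close>). The profile may grow exponentially on a bounded
range of phases, so the frequencies can be taken real.

\<^bold>\<open>Linear algebra at one frequency.\<close> Fix the direction of \<open>\<xi>\<close> and write \<open>R\<close> for the reflection along \<open>\<xi>\<close>.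
The outgoing directions that enter are: \<open>\<omega> = R \<theta>\<close> when no mode conversion takes place, and two
directions in the plane of \<open>\<theta>\<close> and \<open>\<xi>\<close> for conversion of P to S.
The two S to S experiments in which \<open>\<theta>\<close> and \<open>\<alpha>\<close> exchange the roles of \<open>e\<^sub>1\<close> and \<open>e\<^sub>2\<close> measure
the same component of \<open>\<hat>C\<close>, but the right-hand sides differ unless \<open>\<xi>\<^sub>1\<^sup>2 = \<xi>\<^sub>2\<^sup>2\<close>; so \<open>\<hat>\<rho> = 0\<close>
(\<open>laplace_coefficients_vanish\<close>). Then P to S says that the symmetric matrix \<open>\<hat>C(\<cdot>, \<cdot>, a, a)\<close> has the two
converted directions as eigenvectors. They are not orthogonal, so they share their eigenvalue, and P to P
makes it zero (\<open>p_wave_kernel\<close>). All components of \<open>\<hat>C\<close> with a repeated index pair are then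
multiples of a single number \<open>t\<close>, and the six others, shifted by
multiples of \<open>t\<close>, form a symmetric matrix \<open>E\<close> which by S to S solves
\<open>M E = - t |\<xi>|\<^sup>4 B\<close> with explicit symmetric \<open>M\<close> and \<open>B\<close>. Transposing gives \<open>t M B = t B M\<close>; for generic
\<open>\<xi>\<close> these do not commute and \<open>M\<close> is invertible, so \<open>t = 0\<close> and \<open>E = 0\<close> (\<open>tensor_rigidity\<close>).

\<^bold>\<open>Conclusion.\<close> The generic directions form a nonempty open set, so all transforms vanish on an open
convex cone. The exponentials with frequencies in a cone are closed under multiplication, so
the Stone--Weierstrass theorem yields that the coefficients are zero (\<open>laplace_transform_injective\<close>).
\<close>

section \<open>Smooth functions and cutoffs\<close>

text \<open>The closure of a set of functions under the algebraic operations that preserve smoothness. It serves for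
coinduction up to algebra: to see that the functions in \<open>B\<close> are smooth it is enough that their
derivatives lie in \<open>smooth_alg B\<close>.\<close>

inductive_set smooth_alg :: "('a::euclidean_space \<Rightarrow> real) set \<Rightarrow> ('a \<Rightarrow> real) set"
  for B :: "('a \<Rightarrow> real) set" where
  base: "f \<in> B \<Longrightarrow> f \<in> smooth_alg B"
| const: "(\<lambda>x. c) \<in> smooth_alg B"
| add: "f \<in> smooth_alg B \<Longrightarrow> g \<in> smooth_alg B \<Longrightarrow> (\<lambda>x. f x + g x) \<in> smooth_alg B"
| mult: "f \<in> smooth_alg B \<Longrightarrow> g \<in> smooth_alg B \<Longrightarrow> (\<lambda>x. f x * g x) \<in> smooth_alg B"
| inverse: "f \<in> smooth_alg B \<Longrightarrow> (\<And>x. f x \<noteq> 0) \<Longrightarrow> (\<lambda>x. inverse (f x)) \<in> smooth_alg B"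

lemma smooth_coinduct:
  assumes "f \<in> P"
    and "\<And>f x. f \<in> P \<Longrightarrow> f differentiable (at x)"
    and "\<And>f v. f \<in> P \<Longrightarrow> dderiv v f \<in> P"
  shows "smooth f"
proof -
  have "foldr dderiv vs f \<in> P" for vs
    using assms(1,3) by (induction vs) auto
  then show ?thesis
    using assms(2) by (auto simp: smooth_def)
qed

lemma smooth_differentiable: "smooth f \<Longrightarrow> f differentiable (at x)"
  unfolding smooth_def by (metis foldr.simps(1) id_apply)

lemma smooth_dderiv: "smooth f \<Longrightarrow> smooth (dderiv v f)"
proof -
  assume "smooth f"
  then have "foldr dderiv (vs @ [v]) f differentiable at x" for vs x
    unfolding smooth_def by blast
  then show ?thesis unfolding smooth_def by simp
qed

lemma dderiv_eqI: "(f has_derivative f') (at x) \<Longrightarrow> dderiv v f x = f' v"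
  unfolding dderiv_def by (metis frechet_derivative_at)

lemma has_derivative_dderiv:
  "f differentiable (at x) \<Longrightarrow> (f has_derivative (\<lambda>v. dderiv v f x)) (at x)"
  unfolding dderiv_def by (simp add: frechet_derivative_works)

text \<open>By the sum, product and quotient rules, \<open>smooth_alg B\<close> inherits differentiability and closure under
derivatives from \<open>B\<close>.\<close>

lemma smooth_alg_smooth:
  assumes diff: "\<And>f x. f \<in> B \<Longrightarrow> f differentiable (at x)"
    and closed: "\<And>f v. f \<in> B \<Longrightarrow> dderiv v f \<in> smooth_alg B"
    and f: "f \<in> smooth_alg B"
  shows "smooth f"
proof -
  have diffA: "(\<forall>x. f differentiable (at x)) \<and> (\<forall>v. dderiv v f \<in> smooth_alg B)"
    if "f \<in> smooth_alg B" for f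
    using that
  proof induction
    case (base f)
    then show ?case using diff closed by blast
  next
    case (const c)
    have "dderiv v (\<lambda>x. c) = (\<lambda>x. 0)" for v :: 'a
      by (rule ext, rule dderiv_eqI[where f'="\<lambda>_. 0", simplified]) auto
    then show ?case by (auto intro: smooth_alg.const)
  next
    case (add f g)
    then have "dderiv v (\<lambda>x. f x + g x) = (\<lambda>x. dderiv v f x + dderiv v g x)" for v
      by (intro ext dderiv_eqI[where f'="\<lambda>v. dderiv v f x + dderiv v g x" for x])
         (auto intro!: has_derivative_add has_derivative_dderiv)
    then show ?case using add by (auto intro: smooth_alg.add)
  next
    case (mult f g)
    then have "dderiv v (\<lambda>x. f x * g x) = (\<lambda>x. f x * dderiv v g x + dderiv v f x * g x)" for v
      by (intro ext dderiv_eqI[where f'="\<lambda>v. f x * dderiv v g x + dderiv v f x * g x" for x])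
         (auto intro!: has_derivative_mult has_derivative_dderiv)
    then show ?case using mult by (auto intro!: smooth_alg.add smooth_alg.mult)
  next
    case (inverse f)
    then have "dderiv v (\<lambda>x. inverse (f x))
        = (\<lambda>x. -1 * (inverse (f x) * (dderiv v f x * inverse (f x))))" for v
      by (intro ext dderiv_eqI[where f'="\<lambda>v. -1 * (inverse (f x) * (dderiv v f x * inverse (f x)))" for x])
         (auto intro!: has_derivative_eq_rhs[OF Deriv.has_derivative_inverse]
            has_derivative_dderiv)
    moreover have "(\<lambda>x. inverse (f x)) differentiable at x" for x
      using inverse by (auto intro!: differentiable_inverse)
    moreover have "(\<lambda>x. -1 * (inverse (f x) * (dderiv v f x * inverse (f x)))) \<in> smooth_alg B" for v
      using inverse by (intro smooth_alg.mult smooth_alg.inverse smooth_alg.const) auto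
    ultimately show ?case by metis
  qed
  show ?thesis
    by (rule smooth_coinduct[where P="smooth_alg B"]) (use f diffA in auto)
qed

lemma smooth_alg_smooth_Collect:
  "f \<in> smooth_alg {f. smooth f} \<Longrightarrow> smooth f"
  by (rule smooth_alg_smooth[where B="{f. smooth f}"])
    (auto intro: smooth_differentiable smooth_alg.base smooth_dderiv)

lemma smooth_const: "smooth (\<lambda>x::'a::euclidean_space. c)"
  by (rule smooth_alg_smooth_Collect) (auto intro: smooth_alg.intros)

lemma smooth_add: "smooth f \<Longrightarrow> smooth g \<Longrightarrow> smooth (\<lambda>x. f x + g x)"
  by (rule smooth_alg_smooth_Collect) (auto intro: smooth_alg.intros)

lemma smooth_mult: "smooth f \<Longrightarrow> smooth g \<Longrightarrow> smooth (\<lambda>x. f x * g x)"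
  by (rule smooth_alg_smooth_Collect) (auto intro: smooth_alg.intros)

lemma smooth_inverse: "smooth f \<Longrightarrow> (\<And>x. f x \<noteq> 0) \<Longrightarrow> smooth (\<lambda>x. inverse (f x))"
  by (rule smooth_alg_smooth_Collect) (auto intro: smooth_alg.intros)

lemma smooth_sum: "(\<And>i. i \<in> I \<Longrightarrow> smooth (f i)) \<Longrightarrow> smooth (\<lambda>x. \<Sum>i\<in>I. f i x)"
  by (induction I rule: infinite_finite_induct) (auto intro: smooth_const smooth_add)

lemma smooth_linear:
  fixes f :: "'a::euclidean_space \<Rightarrow> real"
  assumes "linear f"
  shows "smooth f"
proof (rule smooth_alg_smooth[where B="{f}"])
  have *: "(f has_derivative f) (at x)" for x
    using assms linear_imp_has_derivative by blast
  then show "g differentiable at x" if "g \<in> {f}" for g x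
    using that by (auto simp: differentiable_def)
  show "dderiv v g \<in> smooth_alg {f}" if "g \<in> {f}" for g v
  proof -
    have "dderiv v f = (\<lambda>x. f v)" using dderiv_eqI[OF *] by auto
    then show ?thesis using that by (auto intro: smooth_alg.const)
  qed
qed (auto intro: smooth_alg.base)

lemma has_derivative_real_compose:
  fixes g :: "'a::euclidean_space \<Rightarrow> real"
  assumes "\<phi> differentiable (at (g x))" "g differentiable (at x)"
  shows "((\<lambda>x. \<phi> (g x)) has_derivative (\<lambda>v. dderiv 1 \<phi> (g x) * dderiv v g x)) (at x)"
proof -
  have 1: "(\<phi> has_derivative (\<lambda>v. dderiv v \<phi> (g x))) (at (g x))"
    using has_derivative_dderiv[OF assms(1)] .
  have 2: "((\<lambda>x. \<phi> (g x)) has_derivative (\<lambda>v. dderiv (dderiv v g x) \<phi> (g x))) (at x)"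
    by (rule has_derivative_compose[OF has_derivative_dderiv[OF assms(2)] 1])
  have 3: "dderiv s \<phi> (g x) = dderiv 1 \<phi> (g x) * s" for s
    using linear_cmul[OF has_derivative_linear[OF 1], of s 1]
    by (simp only: real_scaleR_def mult_1_right) (simp only: mult.commute)
  show ?thesis
    by (rule has_derivative_eq_rhs[OF 2]) (rule ext, rule 3)
qed

text \<open>The chain rule expresses a derivative of \<open>\<phi> \<circ> g\<close> by \<open>\<phi>' \<circ> g\<close> and a derivative of \<open>g\<close>, so the
functions of the form \<open>\<psi> \<circ> g\<close> together with the smooth functions satisfy the coinduction principle.\<close>

lemma smooth_compose_real:
  fixes \<phi> :: "real \<Rightarrow> real"
  assumes "smooth \<phi>" "smooth g"
  shows "smooth (\<lambda>x. \<phi> (g x))"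
proof (rule smooth_alg_smooth)
  let ?B = "{f. smooth f} \<union> {\<lambda>x. \<psi> (g x) |\<psi>. smooth \<psi>}"
  have *: "((\<lambda>x. \<psi> (g x)) has_derivative (\<lambda>v. dderiv 1 \<psi> (g x) * dderiv v g x)) (at x)"
    if "smooth \<psi>" for \<psi> x
    using that assms(2) by (intro has_derivative_real_compose) (auto intro: smooth_differentiable)
  show "f differentiable at x" if "f \<in> ?B" for f x
    using that smooth_differentiable * unfolding differentiable_def by blast
  show "dderiv v f \<in> smooth_alg ?B" if "f \<in> ?B" for f v
  proof (cases "smooth f")
    case True
    then show ?thesis by (auto intro: smooth_alg.base smooth_dderiv)
  next
    case False
    with that obtain \<psi> where \<psi>: "smooth \<psi>" "f = (\<lambda>x. \<psi> (g x))" by blast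
    then have "dderiv v f = (\<lambda>x. dderiv 1 \<psi> (g x) * dderiv v g x)"
      using dderiv_eqI[OF *] by auto
    moreover have "(\<lambda>x. dderiv 1 \<psi> (g x)) \<in> smooth_alg ?B"
      using smooth_dderiv[OF \<psi>(1), of 1] by (intro smooth_alg.base) blast
    moreover have "dderiv v g \<in> smooth_alg ?B"
      using assms(2) by (auto intro: smooth_alg.base smooth_dderiv)
    ultimately show ?thesis by (auto intro: smooth_alg.mult)
  qed
  show "(\<lambda>x. \<phi> (g x)) \<in> smooth_alg ?B"
    using assms by (auto intro: smooth_alg.base)
qed

lemma dderiv_fst:
  assumes "f differentiable (at (fst p))"
  shows "dderiv v (\<lambda>p. f (fst p)) p = dderiv (fst v) f (fst p)"
proof -
  have "((\<lambda>p. f (fst p)) has_derivative (\<lambda>v. dderiv (fst v) f (fst p))) (at p)"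
    by (rule has_derivative_compose[where f=fst and g=f and f'=fst])
      (use has_derivative_dderiv[OF assms] in \<open>auto intro: derivative_eq_intros\<close>)
  then show ?thesis by (rule dderiv_eqI)
qed

lemma smooth_fst:
  fixes f :: "'a::euclidean_space \<Rightarrow> real"
  assumes "smooth f"
  shows "smooth (\<lambda>p::'a \<times> 'b::euclidean_space. f (fst p))"
proof (rule smooth_coinduct[where P="{\<lambda>p. f (fst p) |f. smooth f}"])
  show "h differentiable at p" if "h \<in> {\<lambda>p. f (fst p) |f. smooth f}" 
    for h and p :: "'a \<times> 'b"
  proof -
    from that obtain f where f: "smooth f" "h = (\<lambda>p. f (fst p))" by blast
    have "(f \<circ> fst) differentiable at p"
      using f smooth_differentiable differentiable_chain_at[of fst p f]
      by (metis bounded_linear_fst bounded_linear_imp_differentiable)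
    then show ?thesis using f by (simp add: o_def)
  qed
  show "dderiv v h \<in> {\<lambda>p. f (fst p) |f. smooth f}" if "h \<in> {\<lambda>p. f (fst p) |f. smooth f}" 
    for h and v :: "'a \<times> 'b"
  proof -
    from that obtain f where f: "smooth f" "h = (\<lambda>p. f (fst p))" by blast
    then have "dderiv v h = (\<lambda>p. dderiv (fst v) f (fst p))"
      using dderiv_fst smooth_differentiable by blast
    then show ?thesis using f smooth_dderiv by blast
  qed
qed (use assms in auto)

lemma smooth_continuous: "smooth f \<Longrightarrow> continuous_on A f"
  by (meson continuous_at_imp_continuous_on differentiable_imp_continuous_within smooth_differentiable)

lemma smooth_exp: "smooth (\<lambda>s::real. exp (k * s))"
proof (rule smooth_alg_smooth[where B="{\<lambda>s. exp (k * s)}"])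
  have *: "((\<lambda>s. exp (k * s)) has_derivative (\<lambda>v. exp (k * s) * (k * v))) (at s)" for s
    by (auto intro!: derivative_eq_intros)
  then show "f differentiable at x" if "f \<in> {\<lambda>s. exp (k * s)}" for f x
    using that by (auto simp: differentiable_def)
  have eq: "dderiv v (\<lambda>s. exp (k * s)) = (\<lambda>s. exp (k * s) * (k * v))" for v
    using dderiv_eqI[OF *] by auto
  have "(\<lambda>s. exp (k * s) * (k * v)) \<in> smooth_alg {\<lambda>s. exp (k * s)}" for v
    by (rule smooth_alg.mult[OF smooth_alg.base smooth_alg.const]) simp
  then show "dderiv v f \<in> smooth_alg {\<lambda>s. exp (k * s)}" if "f \<in> {\<lambda>s. exp (k * s)}" for f v
    using that eq by simp
qed (auto intro: smooth_alg.base)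

text \<open>The classical flat function \<open>exp (- 1 / s)\<close> and its products with powers of \<open>1 / s\<close>, whose
linear span is closed under differentiation.\<close>

definition flat :: "nat \<Rightarrow> real \<Rightarrow> real" where
  "flat n s = (if s > 0 then (1 / s) ^ n * exp (- (1 / s)) else 0)"

lemma flat_has_derivative:
  "(flat n has_real_derivative (- real n * flat (n + 1) s + flat (n + 2) s)) (at s)"
proof (cases s "0::real" rule: linorder_cases)
  case greater
  have 1: "((\<lambda>s. 1 / s) has_real_derivative - ((1 / s) * (1 / s))) (at s)"
    using greater by (auto intro!: derivative_eq_intros)
  have "((\<lambda>s. (1 / s) ^ n) has_real_derivative (- real n * (1 / s) ^ (n + 1))) (at s)"
    by (rule DERIV_cong[OF DERIV_power[OF 1]]) (cases n; simp del: of_nat_Suc)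
  moreover have "((\<lambda>s. exp (- (1 / s))) has_real_derivative ((1 / s) * (1 / s)) * exp (- (1 / s))) (at s)"
    by (rule DERIV_cong[OF DERIV_chain2[OF DERIV_exp DERIV_minus[OF 1]]]) simp
  ultimately have "((\<lambda>s. (1 / s) ^ n * exp (- (1 / s))) has_real_derivative
      (- real n * flat (n + 1) s + flat (n + 2) s)) (at s)"
    using greater by (intro DERIV_cong[OF DERIV_mult]) (auto simp: flat_def algebra_simps)
  moreover have e: "\<forall>\<^sub>F s in nhds s. (1 / s) ^ n * exp (- (1 / s)) = flat n s"
    using eventually_nhds_in_open[of "{0<..}" s] greater
    by (auto elim!: eventually_mono simp: flat_def)
  ultimately show ?thesis
    using DERIV_cong_ev[OF refl e refl] by simp
next
  case less
  have "((\<lambda>s. 0) has_real_derivative (- real n * flat (n + 1) s + flat (n + 2) s)) (at s)"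
    using less by (simp add: flat_def)
  moreover have e: "\<forall>\<^sub>F s in nhds s. 0 = flat n s"
    using eventually_nhds_in_open[of "{..<0}" s] less
    by (auto elim!: eventually_mono simp: flat_def)
  ultimately show ?thesis
    using DERIV_cong_ev[OF refl e refl] by simp
next
  case equal
  have lim: "((\<lambda>s. flat n s / s) \<longlongrightarrow> 0) (at 0)"
  proof -
    have "((\<lambda>y. y ^ (n + 1) / exp y) \<longlongrightarrow> 0) (at_top :: real filter)"
      by (rule tendsto_power_div_exp_0)
    then have "((\<lambda>s. inverse s ^ (n + 1) / exp (inverse s)) \<longlongrightarrow> 0) (at_right (0::real))"
      by (rule filterlim_compose) (rule filterlim_inverse_at_top_right)
    moreover have "\<forall>\<^sub>F s in at_right (0::real). inverse s ^ (n + 1) / exp (inverse s) = flat n s / s"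
      by (rule eventually_at_rightI[of 0 1])
        (auto simp: flat_def field_simps exp_minus)
    ultimately have "((\<lambda>s. flat n s / s) \<longlongrightarrow> 0) (at_right 0)"
      using tendsto_cong by force
    moreover have "((\<lambda>s. flat n s / s) \<longlongrightarrow> 0) (at_left 0)"
      by (rule tendsto_eventually, rule eventually_at_leftI[of "-1"]) (auto simp: flat_def)
    ultimately show ?thesis
      by (simp add: filterlim_at_split)
  qed
  then show ?thesis
    using equal by (simp add: DERIV_def flat_def)
qed

lemma smooth_flat: "smooth (flat n)"
proof (rule smooth_alg_smooth[where B="range flat"])
  have *: "(flat n has_derivative (\<lambda>v. (- real n * flat (n + 1) s + flat (n + 2) s) * v)) (at s)" for n s
    using flat_has_derivative[of n s] by (simp add: has_field_derivative_def)
  then show "f differentiable at x" if "f \<in> range flat" for f x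
    using that by (auto simp: differentiable_def)
  show "dderiv v f \<in> smooth_alg (range flat)" if f: "f \<in> range flat" for f v
  proof -
    obtain n where n: "f = flat n" using f by blast
    have eq: "dderiv v (flat n) = (\<lambda>s. (- real n * flat (n + 1) s + flat (n + 2) s) * v)"
      using dderiv_eqI[OF *] by auto
    show ?thesis
      unfolding n eq by (intro smooth_alg.add smooth_alg.mult smooth_alg.const smooth_alg.base rangeI)
  qed
qed (auto intro: smooth_alg.base)

definition cutoff :: "real \<Rightarrow> real \<Rightarrow> real \<Rightarrow> real" where
  "cutoff a b s = flat 0 (b - s) * inverse (flat 0 (b - s) + flat 0 (s - a))"

lemma flat_nonneg: "flat n s \<ge> 0" and flat_pos: "s > 0 \<Longrightarrow> flat n s > 0"
  and flat_zero: "s \<le> 0 \<Longrightarrow> flat n s = 0"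
  by (auto simp: flat_def)

lemma smooth_flat_affine: "smooth (\<lambda>s. flat n (a + b * s))"
  by (intro smooth_compose_real[OF smooth_flat] smooth_add smooth_const smooth_mult smooth_linear)
    (simp add: linear_id[unfolded id_def])

lemma smooth_cutoff:
  assumes "a < b"
  shows "smooth (cutoff a b)"
proof -
  have "flat 0 (b - s) + flat 0 (s - a) > 0" for s
    using assms flat_pos[of "b - s" 0] flat_pos[of "s - a" 0] flat_nonneg[of 0]
    by (cases "s < b") (auto intro: add_pos_nonneg add_nonneg_pos)
  then have "flat 0 (b - s) + flat 0 (s - a) \<noteq> 0" for s
    by (metis less_irrefl)
  moreover have "smooth (\<lambda>s. flat 0 (b - s))" "smooth (\<lambda>s. flat 0 (s - a))"
    using smooth_flat_affine[of 0 b "-1"] smooth_flat_affine[of 0 "-a" 1] by simp_all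
  ultimately show ?thesis
    unfolding cutoff_def by (intro smooth_mult smooth_inverse smooth_add) auto
qed

lemma cutoff_one: "a < b \<Longrightarrow> s \<le> a \<Longrightarrow> cutoff a b s = 1"
  using flat_pos[of "b - s" 0] by (simp add: cutoff_def flat_zero)

lemma cutoff_zero: "b \<le> s \<Longrightarrow> cutoff a b s = 0"
  by (simp add: cutoff_def flat_zero)

section \<open>The Laplace transform on an open cone\<close>

lemma integrable_continuous_compact_support:
  fixes f :: "'a::euclidean_space \<Rightarrow> real"
  assumes "continuous_on UNIV f" "compact S" "\<And>x. x \<notin> S \<Longrightarrow> f x = 0"
  shows "integrable lborel f"
proof -
  have "integrable lborel (\<lambda>x. indicator S x *\<^sub>R f x)"
    using assms by (intro borel_integrable_compact) (auto intro: continuous_on_subset)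
  moreover have "(\<lambda>x. indicator S x *\<^sub>R f x) = f"
    using assms(3) by (auto simp: fun_eq_iff indicator_def)
  ultimately show ?thesis by simp
qed

text \<open>A continuous function that is zero almost everywhere is zero, because its zero set is closed and a closed
set of full measure is everything.\<close>

lemma continuous_integral_square_eq_0:
  fixes g :: "'a::euclidean_space \<Rightarrow> real"
  assumes "continuous_on UNIV g" "compact S" "\<And>x. x \<notin> S \<Longrightarrow> g x = 0"
    and "(\<integral>x. g x * g x \<partial>lborel) = 0"
  shows "g x = 0"
proof -
  have "integrable lborel (\<lambda>x. g x * g x)"
    using assms by (intro integrable_continuous_compact_support[of _ S] continuous_intros) auto
  then have "AE x in lborel. g x * g x = 0"
    using assms(4) by (subst (asm) integral_nonneg_eq_0_iff_AE) auto
  then have "AE x in lebesgue. x \<in> {x. g x = 0}"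
    by (intro AE_completion) auto
  moreover have "closed {x. g x = 0}"
    using assms(1) by (intro closed_Collect_eq) auto
  ultimately show ?thesis
    using mem_closed_if_AE_lebesgue by blast
qed

text \<open>The functions \<open>h\<close> for which the Laplace transform of \<open>g h\<close> vanishes on \<open>K\<close> form a module over all
exponentials with frequency in \<open>K\<close>, because \<open>K\<close> is closed under addition. The multipliers of this
module are an algebra that contains the constants and separates points, since \<open>K\<close> is open; by
Stone--Weierstrass they are dense, and in the limit \<open>g\<close> is orthogonal to itself.\<close>

lemma laplace_transform_injective:
  fixes g :: "'a::euclidean_space \<Rightarrow> real"
  assumes g: "continuous_on UNIV g" and S: "compact S" "\<And>x. x \<notin> S \<Longrightarrow> g x = 0"
    and K: "open K" "K \<noteq> {}" "\<And>\<xi> \<eta>. \<xi> \<in> K \<Longrightarrow> \<eta> \<in> K \<Longrightarrow> \<xi> + \<eta> \<in> K"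
    and zero: "\<And>\<xi>. \<xi> \<in> K \<Longrightarrow> (\<integral>x. g x * exp (\<xi> \<bullet> x) \<partial>lborel) = 0"
  shows "g x = 0"
proof -
  obtain \<xi>0 where \<xi>0: "\<xi>0 \<in> K" using K by blast
  define Ann where "Ann = {h. continuous_on UNIV h \<and>
      (\<forall>\<xi>\<in>K. (\<integral>x. g x * h x * exp (\<xi> \<bullet> x) \<partial>lborel) = 0)}"
  define P where "P f \<longleftrightarrow> continuous_on UNIV f \<and> (\<forall>h\<in>Ann. (\<lambda>x. h x * f x) \<in> Ann)" for f
  have int: "integrable lborel (\<lambda>x. g x * h x)" if "continuous_on UNIV h" for h
    using g S that by (intro integrable_continuous_compact_support[of _ S] continuous_intros) auto
  have one: "(\<lambda>x. 1) \<in> Ann"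
    using zero by (auto simp: Ann_def)
  have Pconst: "P (\<lambda>x. c)" for c
    by (auto simp: P_def Ann_def mult_ac intro!: continuous_intros)
  have Padd: "P (\<lambda>x. f1 x + f2 x)" if "P f1" "P f2" for f1 f2
    unfolding P_def
  proof (intro conjI ballI)
    fix h assume h: "h \<in> Ann"
    have 1: "(\<lambda>x. h x * f1 x) \<in> Ann" "(\<lambda>x. h x * f2 x) \<in> Ann" using that h by (auto simp: P_def)
    have "(\<integral>x. g x * (h x * (f1 x + f2 x)) * exp (\<xi> \<bullet> x) \<partial>lborel) = 0" if "\<xi> \<in> K" for \<xi>
    proof -
      have 2: "integrable lborel (\<lambda>x. g x * (h x * f1 x * exp (\<xi> \<bullet> x)))"
        "integrable lborel (\<lambda>x. g x * (h x * f2 x * exp (\<xi> \<bullet> x)))"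
        using 1 by (auto simp: Ann_def intro!: int continuous_intros)
      have "(\<integral>x. g x * (h x * (f1 x + f2 x)) * exp (\<xi> \<bullet> x) \<partial>lborel)
        = (\<integral>x. g x * (h x * f1 x * exp (\<xi> \<bullet> x)) + g x * (h x * f2 x * exp (\<xi> \<bullet> x)) \<partial>lborel)"
        by (simp add: algebra_simps)
      also have "\<dots> = (\<integral>x. g x * (h x * f1 x * exp (\<xi> \<bullet> x)) \<partial>lborel) + (\<integral>x. g x * (h x * f2 x * exp (\<xi> \<bullet> x)) \<partial>lborel)"
        using 2 by simp
      also have "\<dots> = 0"
        using 1 that by (simp add: Ann_def mult.assoc)
      finally show ?thesis .
    qed
    moreover have "continuous_on UNIV (\<lambda>x. h x * (f1 x + f2 x))"
      using h that by (auto simp: P_def Ann_def intro!: continuous_intros)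
    ultimately show "(\<lambda>x. h x * (f1 x + f2 x)) \<in> Ann" by (simp add: Ann_def)
  qed (use that in \<open>auto simp: P_def intro!: continuous_intros\<close>)
  have Pmult: "P (\<lambda>x. f1 x * f2 x)" if "P f1" "P f2" for f1 f2
  proof -
    have "(\<lambda>x. h x * (f1 x * f2 x)) \<in> Ann" if "h \<in> Ann" for h
    proof -
      have "(\<lambda>x. h x * f1 x) \<in> Ann" using that \<open>P f1\<close> by (auto simp: P_def)
      then have "(\<lambda>x. h x * f1 x * f2 x) \<in> Ann" using \<open>P f2\<close> by (auto simp: P_def)
      then show ?thesis by (simp add: mult.assoc)
    qed
    then show ?thesis using that by (auto simp: P_def intro!: continuous_intros)
  qed
  have Pexp: "P (\<lambda>x. exp (\<eta> \<bullet> x))" if "\<eta> \<in> K" for \<eta>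
    unfolding P_def
  proof (intro conjI ballI)
    fix h assume h: "h \<in> Ann"
    have "(\<integral>x. g x * (h x * exp (\<eta> \<bullet> x)) * exp (\<xi> \<bullet> x) \<partial>lborel) = 0" if "\<xi> \<in> K" for \<xi>
    proof -
      have "(\<integral>x. g x * h x * exp ((\<eta> + \<xi>) \<bullet> x) \<partial>lborel) = 0"
        using h K(3) that \<open>\<eta> \<in> K\<close> by (auto simp: Ann_def)
      then show ?thesis by (simp add: inner_add_left exp_add mult.assoc)
    qed
    then show "(\<lambda>x. h x * exp (\<eta> \<bullet> x)) \<in> Ann"
      using h by (auto simp: Ann_def intro!: continuous_intros)
  qed (intro continuous_intros)
  have Psep: "\<exists>f. P f \<and> f x \<noteq> f y" if "x \<noteq> y" for x y
  proof -
    have "\<exists>\<xi>\<in>K. \<xi> \<bullet> x \<noteq> \<xi> \<bullet> y"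
    proof (cases "\<xi>0 \<bullet> x = \<xi>0 \<bullet> y")
      case True
      obtain e where e: "e > 0" "ball \<xi>0 e \<subseteq> K" using K(1) \<xi>0 openE by blast
      \<comment> \<open>if \<open>\<xi>0\<close> does not separate the points, a frequency in \<open>K\<close> slightly off along \<open>x - y\<close> does\<close>
      define d where "d = e / 2 / norm (x - y)"
      have "d > 0" using e that by (simp add: d_def)
      have "\<xi>0 + d *\<^sub>R (x - y) \<in> K"
        using e that by (intro subsetD[OF e(2)]) (simp add: dist_norm d_def)
      moreover have "(\<xi>0 + d *\<^sub>R (x - y)) \<bullet> (x - y) = d * ((x - y) \<bullet> (x - y))"
        using True by (simp add: inner_add_left inner_diff_right right_diff_distrib)
      then have "(\<xi>0 + d *\<^sub>R (x - y)) \<bullet> (x - y) \<noteq> 0"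
        using \<open>d > 0\<close> that by simp
      ultimately show ?thesis by (metis inner_diff_right right_minus_eq)
    qed (use \<xi>0 in auto)
    then obtain \<xi> where "\<xi> \<in> K" "\<xi> \<bullet> x \<noteq> \<xi> \<bullet> y" by blast
    then show ?thesis using Pexp by (intro exI[of _ "\<lambda>x. exp (\<xi> \<bullet> x)"]) auto
  qed
  \<comment> \<open>\<open>g\<^sup>2 = w f\<close>, where \<open>w\<close> is orthogonal to every multiplier \<open>p\<close>, as \<open>\<xi>0 \<in> K\<close>; the bound follows by approximating \<open>f\<close> by such \<open>p\<close>\<close>
  define w where "w x = g x * exp (\<xi>0 \<bullet> x)" for x
  define f where "f x = g x * exp (- (\<xi>0 \<bullet> x))" for x
  have w: "continuous_on UNIV w" "\<And>x. x \<notin> S \<Longrightarrow> w x = 0"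
    unfolding w_def using g S by (auto intro!: continuous_intros)
  have intw: "integrable lborel (\<lambda>x. \<bar>w x\<bar>)"
    using w S by (intro integrable_continuous_compact_support[of _ S] continuous_intros) auto
  have gg: "g x * g x = w x * f x" for x
    by (simp add: w_def f_def exp_minus field_simps)
  have bound: "(\<integral>x. g x * g x \<partial>lborel) \<le> e * (\<integral>x. \<bar>w x\<bar> \<partial>lborel)" if e: "e > 0" for e
  proof -
    have "\<exists>p. P p \<and> (\<forall>x\<in>S. \<bar>f x - p x\<bar> < e)"
    proof (rule Stone_Weierstrass_HOL)
      show "continuous_on S f"
        unfolding f_def using continuous_on_subset[OF g] by (auto intro!: continuous_intros)
      show "continuous_on S h" if "P h" for h
        using that continuous_on_subset by (auto simp: P_def)
    qed (use S(1) Pconst Padd Pmult Psep e in auto)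
    then obtain p where p: "P p" "\<forall>x\<in>S. \<bar>f x - p x\<bar> < e" by blast
    have cp: "continuous_on UNIV p" and cf: "continuous_on UNIV f"
      using p g by (auto simp: P_def f_def intro!: continuous_intros)
    have "(\<lambda>x. 1 * p x) \<in> Ann" using p one by (auto simp: P_def)
    then have p0: "(\<integral>x. w x * p x \<partial>lborel) = 0"
      using \<xi>0 by (auto simp: Ann_def w_def mult_ac)
    have i1: "integrable lborel (\<lambda>x. w x * f x)" and i2: "integrable lborel (\<lambda>x. w x * p x)"
      using w S cp cf by (auto intro!: integrable_continuous_compact_support[of _ S] continuous_intros)
    have "(\<integral>x. g x * g x \<partial>lborel) = (\<integral>x. w x * f x - w x * p x \<partial>lborel)"
      using i1 i2 p0 by (simp add: gg)
    also have "\<dots> \<le> (\<integral>x. e * \<bar>w x\<bar> \<partial>lborel)"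
    proof (rule integral_mono)
      show "w x * f x - w x * p x \<le> e * \<bar>w x\<bar>" for x
      proof (cases "x \<in> S")
        case True
        have "w x * f x - w x * p x \<le> \<bar>w x\<bar> * \<bar>f x - p x\<bar>"
          by (metis abs_ge_self abs_mult right_diff_distrib)
        also have "\<dots> \<le> \<bar>w x\<bar> * e" using p(2) True by (intro mult_left_mono) auto
        finally show ?thesis by (simp add: mult.commute)
      qed (use w in auto)
    qed (use i1 i2 intw in auto)
    finally show ?thesis by simp
  qed
  have "(\<integral>x. g x * g x \<partial>lborel) \<le> 0"
  proof (rule field_le_epsilon)
    fix e :: real assume e: "e > 0"
    let ?I = "\<integral>x. \<bar>w x\<bar> \<partial>lborel"
    have I: "?I \<ge> 0" by simp
    have "(\<integral>x. g x * g x \<partial>lborel) \<le> e / (?I + 1) * ?I"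
      using bound[of "e / (?I + 1)"] e I by simp
    also have "\<dots> = e * (?I / (?I + 1))" by simp
    also have "\<dots> \<le> e * 1"
      using e I by (intro mult_left_mono) (auto simp: divide_le_eq_1 add_nonneg_pos)
    finally show "(\<integral>x. g x * g x \<partial>lborel) \<le> 0 + e" by simp
  qed
  moreover have "(\<integral>x. g x * g x \<partial>lborel) \<ge> 0" by simp
  ultimately show ?thesis
    using continuous_integral_square_eq_0[OF g S] by (meson order_antisym)
qed

text \<open>A cone over a convex set is closed under addition.\<close>

lemma open_cone_over_ball:
  fixes \<xi>0 :: "'a::euclidean_space" and e :: real
  defines "K \<equiv> (\<Union>s\<in>{0<..}. (*\<^sub>R) s ` ball \<xi>0 e)"
  shows "open K" and "\<And>\<xi> \<eta>. \<xi> \<in> K \<Longrightarrow> \<eta> \<in> K \<Longrightarrow> \<xi> + \<eta> \<in> K"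
proof -
  show "open K" unfolding K_def by (intro open_UN ballI open_scaling) auto
  fix \<xi> \<eta> assume "\<xi> \<in> K" "\<eta> \<in> K"
  then obtain s t x y where s: "s > 0" "x \<in> ball \<xi>0 e" "\<xi> = s *\<^sub>R x" and t: "t > 0" "y \<in> ball \<xi>0 e" "\<eta> = t *\<^sub>R y"
    by (auto simp: K_def)
  have "(s / (s + t)) *\<^sub>R x + (t / (s + t)) *\<^sub>R y \<in> ball \<xi>0 e"
    using s t by (intro convexD[OF convex_ball]) (auto simp: add_divide_distrib[symmetric])
  moreover have "\<xi> + \<eta> = (s + t) *\<^sub>R ((s / (s + t)) *\<^sub>R x + (t / (s + t)) *\<^sub>R y)"
    using s t by (simp add: scaleR_add_right)
  ultimately show "\<xi> + \<eta> \<in> K"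
    unfolding K_def using s t by (intro UN_I[of "s + t"] image_eqI[of _ "(*\<^sub>R) (s + t)"]) auto
qed

section \<open>Test functions and distributions\<close>

lemma dderiv_transform_open:
  assumes "open U" "x \<in> U" "\<And>y. y \<in> U \<Longrightarrow> f y = g y" "g differentiable (at x)"
  shows "dderiv v f x = dderiv v g x"
proof -
  have "(f has_derivative (\<lambda>v. dderiv v g x)) (at x)"
    by (rule has_derivative_transform_within_open[OF has_derivative_dderiv[OF assms(4)] assms(1,2)])
      (use assms(3) in auto)
  then show ?thesis by (rule dderiv_eqI)
qed

lemma dderiv_const: "dderiv v (\<lambda>x. c) x = 0"
  by (rule dderiv_eqI[where f'="\<lambda>_. 0", simplified]) auto

lemma dderiv_outside_support:
  assumes "closed S" "\<And>x. x \<notin> S \<Longrightarrow> f x = 0" "x \<notin> S"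
  shows "dderiv v f x = 0"
  using dderiv_transform_open[of "- S" x f "\<lambda>x. 0" v] assms dderiv_const[of v 0 x] by auto

lemma Cc_infI:
  assumes "smooth f" "compact S" "\<And>x. x \<notin> S \<Longrightarrow> f x = 0" "S \<subseteq> A"
  shows "f \<in> Cc_inf A"
proof -
  have "fsupport f \<subseteq> S"
    unfolding fsupport_def using assms(2,3) by (intro closure_minimal) (auto intro: compact_imp_closed)
  moreover from this have "compact (fsupport f)"
    using assms(2) by (metis closed_closure compact_Int_closed fsupport_def inf.absorb2)
  ultimately show ?thesis using assms by (auto simp: Cc_inf_def)
qed

lemma Cc_infE:
  assumes "f \<in> Cc_inf A"
  obtains S where "smooth f" "compact S" "\<And>x. x \<notin> S \<Longrightarrow> f x = 0" "S \<subseteq> A"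
proof (rule that)
  show "smooth f" "compact (fsupport f)" "fsupport f \<subseteq> A" using assms by (auto simp: Cc_inf_def)
  show "f x = 0" if "x \<notin> fsupport f" for x
    using that closure_subset[of "{x. f x \<noteq> 0}"] by (auto simp: fsupport_def)
qed

lemma Cc_inf_dderiv: "f \<in> Cc_inf A \<Longrightarrow> dderiv v f \<in> Cc_inf A"
  by (elim Cc_infE, rule Cc_infI) (auto intro: smooth_dderiv dderiv_outside_support compact_imp_closed)

lemma Cc_inf_mult_left: "smooth g \<Longrightarrow> f \<in> Cc_inf A \<Longrightarrow> (\<lambda>x. g x * f x) \<in> Cc_inf A"
  by (elim Cc_infE, rule Cc_infI) (auto intro: smooth_mult)

lemma Cc_inf_add: "f \<in> Cc_inf A \<Longrightarrow> g \<in> Cc_inf A \<Longrightarrow> (\<lambda>x. f x + g x) \<in> Cc_inf A"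
proof (elim Cc_infE)
  fix S S' assume "smooth f" "compact S" "\<And>x. x \<notin> S \<Longrightarrow> f x = 0" "S \<subseteq> A"
    "smooth g" "compact S'" "\<And>x. x \<notin> S' \<Longrightarrow> g x = 0" "S' \<subseteq> A"
  then show ?thesis
    by (intro Cc_infI[of _ "S \<union> S'"]) (auto intro: smooth_add)
qed

lemma Cc_inf_scale: "f \<in> Cc_inf A \<Longrightarrow> (\<lambda>x. c * f x) \<in> Cc_inf A"
  by (rule Cc_inf_mult_left[OF smooth_const])

lemma Cc_inf_zero: "(\<lambda>x. 0) \<in> Cc_inf A"
  by (rule Cc_infI[of _ "{}"]) (auto intro: smooth_const)

lemma Cc_inf_sum: "(\<And>i. i \<in> I \<Longrightarrow> f i \<in> Cc_inf A) \<Longrightarrow> (\<lambda>x. \<Sum>i\<in>I. f i x) \<in> Cc_inf A"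
  by (induction I rule: infinite_finite_induct) (auto intro: Cc_inf_zero Cc_inf_add)

lemma Cc_inf_mono: "A \<subseteq> A' \<Longrightarrow> Cc_inf A \<subseteq> Cc_inf A'"
  by (auto simp: Cc_inf_def)

lemma Cc_inf_integrable: "f \<in> Cc_inf A \<Longrightarrow> integrable lborel f"
  by (elim Cc_infE, rule integrable_continuous_compact_support) (auto intro: smooth_continuous)

lemma distribution_lin:
  assumes "distribution u" "f \<in> Cc_inf UNIV" "g \<in> Cc_inf UNIV"
  shows "u (\<lambda>x. a * f x + b * g x) = a * u f + b * u g"
  using assms by (simp add: distribution_def)

lemma distribution_scale:
  assumes "distribution u" "f \<in> Cc_inf UNIV"
  shows "u (\<lambda>x. a * f x) = a * u f"
  using distribution_lin[OF assms assms(2), of a 0] by simp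

lemma distribution_sum:
  assumes u: "distribution u" and f: "\<And>i. i \<in> I \<Longrightarrow> f i \<in> Cc_inf UNIV" and "finite I"
  shows "u (\<lambda>x. \<Sum>i\<in>I. f i x) = (\<Sum>i\<in>I. u (f i))"
  using \<open>finite I\<close> f
proof (induction I rule: finite_induct)
  case empty
  then show ?case using distribution_scale[OF u Cc_inf_zero, of 0] by simp
next
  case (insert i I)
  then have "u (\<lambda>x. 1 * f i x + 1 * (\<Sum>i\<in>I. f i x)) = 1 * u (f i) + 1 * u (\<lambda>x. \<Sum>i\<in>I. f i x)"
    by (intro distribution_lin u Cc_inf_sum) auto
  then show ?case using insert by simp
qed

section \<open>Plane waves as test functions\<close>

definition phase :: "real \<Rightarrow> real^3 \<Rightarrow> spacetime \<Rightarrow> real" where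
  "phase c \<omega> p = c * snd p - \<omega> \<bullet> fst p"

text \<open>The wave \<open>\<phi>(c t - \<omega> \<bullet> x)\<close>, multiplied by a function of \<open>x \<bullet> x\<close> that is 1 on the closed unit ball
and 0 where the norm of \<open>x\<close> is at least 2. The square makes the cutoff smooth at the origin.\<close>

definition plane_wave_test :: "real \<Rightarrow> real^3 \<Rightarrow> (real \<Rightarrow> real) \<Rightarrow> spacetime \<Rightarrow> real" where
  "plane_wave_test c \<omega> \<phi> p = cutoff 1 4 (fst p \<bullet> fst p) * \<phi> (phase c \<omega> p)"

lemma linear_phase: "linear (phase c \<omega>)"
  by (rule linearI) (simp_all add: phase_def inner_add_right algebra_simps)

lemma dderiv_phase: "dderiv v (phase c \<omega>) p = phase c \<omega> v"
  by (rule dderiv_eqI[OF linear_imp_has_derivative[OF linear_phase]])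

lemma dderiv_comp_phase:
  assumes "smooth \<phi>"
  shows "dderiv v (\<lambda>p. k * \<phi> (phase c \<omega> p)) p = k * phase c \<omega> v * dderiv 1 \<phi> (phase c \<omega> p)"
proof -
  have "((\<lambda>p. \<phi> (phase c \<omega> p)) has_derivative
      (\<lambda>v. dderiv 1 \<phi> (phase c \<omega> p) * dderiv v (phase c \<omega>) p)) (at p)"
    by (rule has_derivative_real_compose[OF smooth_differentiable[OF assms]
          smooth_differentiable[OF smooth_linear[OF linear_phase]]])
  from dderiv_eqI[OF has_derivative_mult_right[OF this, of k]]
  show ?thesis by (simp add: dderiv_phase mult_ac)
qed

lemma smooth_comp_phase: "smooth \<phi> \<Longrightarrow> smooth (\<lambda>p. \<phi> (phase c \<omega> p))"
  by (rule smooth_compose_real[OF _ smooth_linear[OF linear_phase]])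

lemma smooth_inner_self: "smooth (\<lambda>x::real^3. x \<bullet> x)"
proof -
  have "smooth (\<lambda>x::real^3. \<Sum>i\<in>UNIV. x $ i * x $ i)"
    by (intro smooth_sum smooth_mult smooth_linear) (auto intro: linearI)
  then show ?thesis by (simp add: inner_vec_def)
qed

lemma smooth_plane_wave_test:
  assumes "smooth \<phi>"
  shows "smooth (plane_wave_test c \<omega> \<phi>)"
proof -
  have "smooth (\<lambda>p::spacetime. cutoff 1 4 (fst p \<bullet> fst p))"
    by (rule smooth_fst[where f="\<lambda>x. cutoff 1 4 (x \<bullet> x)"])
      (rule smooth_compose_real[OF smooth_cutoff smooth_inner_self], simp)
  moreover have "smooth (\<lambda>p. \<phi> (phase c \<omega> p))"
    by (rule smooth_comp_phase[OF assms])
  ultimately show ?thesis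
    unfolding plane_wave_test_def[abs_def] by (rule smooth_mult)
qed

text \<open>Contains the support of \<open>plane_wave_test c \<omega> \<phi>\<close> when \<open>\<phi>\<close> vanishes outside the interval from \<open>- b\<close> to \<open>b\<close>.\<close>

definition slab :: "real \<Rightarrow> real \<Rightarrow> spacetime set" where
  "slab c b = cball 0 2 \<times> {- ((b + 2) / c) .. (b + 2) / c}"

lemma plane_wave_test_outside_slab:
  assumes c: "c > 0" and \<omega>: "norm \<omega> = 1" and \<phi>: "\<And>s. \<bar>s\<bar> \<ge> b \<Longrightarrow> \<phi> s = 0"
    and p: "p \<notin> slab c b"
  shows "plane_wave_test c \<omega> \<phi> p = 0"
proof (cases "norm (fst p) \<le> 2")
  case False
  then have "2\<^sup>2 \<le> (norm (fst p))\<^sup>2" by (intro power_mono) auto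
  then have "4 \<le> fst p \<bullet> fst p" by (simp add: power2_norm_eq_inner)
  then show ?thesis by (simp add: plane_wave_test_def cutoff_zero)
next
  case True
  then have "\<bar>snd p\<bar> > (b + 2) / c"
    using p by (cases p) (auto simp: slab_def)
  then have 1: "b + 2 < \<bar>c * snd p\<bar>" using c by (simp add: field_simps abs_mult)
  have "\<bar>\<omega> \<bullet> fst p\<bar> \<le> 2" using Cauchy_Schwarz_ineq2[of \<omega> "fst p"] \<omega> True by simp
  then have "\<bar>phase c \<omega> p\<bar> \<ge> b" using 1 by (simp add: phase_def)
  then show ?thesis by (simp add: plane_wave_test_def \<phi>)
qed

lemma Cc_inf_plane_wave_test:
  assumes "c > 0" "norm \<omega> = 1" "smooth \<phi>" "\<And>s. \<bar>s\<bar> \<ge> b \<Longrightarrow> \<phi> s = 0"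
  shows "plane_wave_test c \<omega> \<phi> \<in> Cc_inf (slab c b)"
proof (rule Cc_infI[of _ "slab c b"])
  show "compact (slab c b)" unfolding slab_def by (intro compact_Times) auto
  show "plane_wave_test c \<omega> \<phi> p = 0" if "p \<notin> slab c b" for p
    by (rule plane_wave_test_outside_slab[OF assms(1,2,4) that])
qed (use assms(3) smooth_plane_wave_test in auto)

lemma open_cylinder: "open (ball (0::real^3) 1 \<times> (UNIV::real set))"
  by (intro open_Times) auto

lemma plane_wave_test_inside:
  assumes "norm x < 1"
  shows "plane_wave_test c \<omega> \<phi> (x, t) = \<phi> (phase c \<omega> (x, t))"
proof -
  have "(norm x)\<^sup>2 \<le> 1" using assms by (intro power_le_one) auto
  then have "x \<bullet> x \<le> 1" by (simp only: power2_norm_eq_inner)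
  then show ?thesis by (simp add: plane_wave_test_def cutoff_one)
qed

lemma dderiv_plane_wave_test:
  assumes "smooth \<phi>" "norm (fst p) < 1"
  shows "dderiv v (plane_wave_test c \<omega> \<phi>) p = phase c \<omega> v * dderiv 1 \<phi> (phase c \<omega> p)"
proof -
  have "dderiv v (plane_wave_test c \<omega> \<phi>) p = dderiv v (\<lambda>p. 1 * \<phi> (phase c \<omega> p)) p"
  proof (rule dderiv_transform_open[OF open_cylinder])
    show "(\<lambda>p. 1 * \<phi> (phase c \<omega> p)) differentiable at p"
      using assms by (intro smooth_differentiable smooth_mult smooth_const smooth_comp_phase)
  qed (use assms plane_wave_test_inside in \<open>auto simp: mem_Times_iff\<close>)
  then show ?thesis using dderiv_comp_phase[OF assms(1), of v 1] by simp
qed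

lemma dderiv2_plane_wave_test:
  assumes "smooth \<phi>" "norm (fst p) < 1"
  shows "dderiv w (dderiv v (plane_wave_test c \<omega> \<phi>)) p
     = phase c \<omega> v * phase c \<omega> w * dderiv 1 (dderiv 1 \<phi>) (phase c \<omega> p)"
proof -
  have "dderiv w (dderiv v (plane_wave_test c \<omega> \<phi>)) p
      = dderiv w (\<lambda>p. phase c \<omega> v * dderiv 1 \<phi> (phase c \<omega> p)) p"
  proof (rule dderiv_transform_open[OF open_cylinder])
    show "(\<lambda>p. phase c \<omega> v * dderiv 1 \<phi> (phase c \<omega> p)) differentiable at p"
      using assms by (intro smooth_differentiable smooth_mult smooth_const smooth_comp_phase smooth_dderiv)
  qed (use assms dderiv_plane_wave_test in \<open>auto simp: mem_Times_iff\<close>)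
  then show ?thesis using assms by (simp add: dderiv_comp_phase smooth_dderiv)
qed

lemma phase_axis: "phase c \<omega> (axis k 1, 0) = - \<omega> $ k" and phase_time: "phase c \<omega> (0, 1) = c"
  by (simp_all add: phase_def inner_axis)

abbreviation dx :: "3 \<Rightarrow> (spacetime \<Rightarrow> real) \<Rightarrow> spacetime \<Rightarrow> real" where
  "dx k \<equiv> dderiv (axis k 1, 0)"
abbreviation dt :: "(spacetime \<Rightarrow> real) \<Rightarrow> spacetime \<Rightarrow> real" where
  "dt \<equiv> dderiv (0, 1)"

text \<open>The \<open>j\<close>-th component of the elastic operator applied to the vector field \<open>\<beta> F\<close>; the operator is
formally self-adjoint.\<close>

definition elastic_adjoint :: "real \<Rightarrow> real \<Rightarrow> real^3 \<Rightarrow> 3 \<Rightarrow> (spacetime \<Rightarrow> real) \<Rightarrow> spacetime \<Rightarrow> real" where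
  "elastic_adjoint lam mu \<beta> j F p = \<beta> $ j * dt (dt F) p
     + (- (lam + mu)) * (\<Sum>i\<in>UNIV. \<beta> $ i * dx j (dx i F) p) + (- mu * \<beta> $ j) * (\<Sum>k\<in>UNIV. dx k (dx k F) p)"

text \<open>The direction \<open>\<omega>\<close>, speed \<open>c\<close> and polarization \<open>\<beta>\<close> of a plane P- or S-wave of the background medium.\<close>

definition admissible :: "real \<Rightarrow> real \<Rightarrow> real \<Rightarrow> real^3 \<Rightarrow> real^3 \<Rightarrow> bool" where
  "admissible lam mu c \<omega> \<beta> \<longleftrightarrow> norm \<omega> = 1 \<and>
     (c = c_p lam mu \<and> \<beta> = \<omega> \<or> c = c_s mu \<and> \<beta> \<bullet> \<omega> = 0)"

text \<open>In the ball the cutoff is 1, so the test field is an exact solution of the elastic wave equation.\<close>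

lemma elastic_adjoint_plane_wave:
  assumes "mu > 0" "lam + 2 * mu > 0" "admissible lam mu c \<omega> \<beta>" "smooth \<phi>" "norm (fst p) < 1"
  shows "elastic_adjoint lam mu \<beta> j (plane_wave_test c \<omega> \<phi>) p = 0"
proof -
  let ?q = "dderiv 1 (dderiv 1 \<phi>) (phase c \<omega> p)"
  have "\<omega> \<bullet> \<omega> = 1" using assms(3) by (simp add: admissible_def norm_eq_1)
  then have n: "(\<Sum>k\<in>UNIV. \<omega> $ k * \<omega> $ k) = 1" by (simp add: inner_vec_def)
  have "elastic_adjoint lam mu \<beta> j (plane_wave_test c \<omega> \<phi>) p
      = (\<beta> $ j * (c * c) - (lam + mu) * \<omega> $ j * (\<Sum>i\<in>UNIV. \<beta> $ i * \<omega> $ i)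
          - mu * \<beta> $ j * (\<Sum>k\<in>UNIV. \<omega> $ k * \<omega> $ k)) * ?q"
    unfolding elastic_adjoint_def dderiv2_plane_wave_test[OF assms(4,5)] phase_axis phase_time
    by (simp add: sum_3 algebra_simps)
  also have "(\<Sum>i\<in>UNIV. \<beta> $ i * \<omega> $ i) = \<beta> \<bullet> \<omega>" by (simp add: inner_vec_def)
  also have "\<beta> $ j * (c * c) - (lam + mu) * \<omega> $ j * (\<beta> \<bullet> \<omega>) - mu * \<beta> $ j * (\<Sum>k\<in>UNIV. \<omega> $ k * \<omega> $ k) = 0"
    using assms(1-3) \<open>\<omega> \<bullet> \<omega> = 1\<close> by (auto simp: n admissible_def c_p_def c_s_def algebra_simps)
  finally show ?thesis by simp
qed

text \<open>The elastic operator applied to the truncated plane wave is zero in the ball, and \<open>(b + 2) / c\<close> is the time by which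
the plane wave has left the ball of radius 2. So only the region where \<open>u\<close> is known to vanish
contributes.\<close>

lemma elastic_adjoint_vanishing:
  assumes u: "\<And>m. distribution (u m)" "\<And>m. vanishes_on (u m) ((- ball 0 1) \<times> {..T})"
    and mu: "mu > 0" "lam + 2 * mu > 0" and c: "c > 0" "admissible lam mu c \<omega> \<beta>"
    and \<phi>: "smooth \<phi>" "\<And>s. \<bar>s\<bar> \<ge> b \<Longrightarrow> \<phi> s = 0" and T: "(b + 2) / c \<le> T"
  shows "u j (elastic_adjoint lam mu \<beta> j (plane_wave_test c \<omega> \<phi>)) = 0"
proof -
  let ?F = "plane_wave_test c \<omega> \<phi>" and ?w = "elastic_adjoint lam mu \<beta> j (plane_wave_test c \<omega> \<phi>)"
  have F: "?F \<in> Cc_inf (slab c b)"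
    using c \<phi> by (intro Cc_inf_plane_wave_test) (auto simp: admissible_def)
  then have w: "?w \<in> Cc_inf (slab c b)"
    unfolding elastic_adjoint_def[abs_def]
    by (intro Cc_inf_add Cc_inf_scale Cc_inf_sum Cc_inf_dderiv)
  have "?w \<in> Cc_inf ((- ball 0 1) \<times> {..T})"
  proof (rule Cc_infI)
    show "smooth ?w" using w by (simp add: Cc_inf_def)
    show "compact (slab c b \<inter> ((- ball 0 1) \<times> UNIV))"
      by (intro compact_Int_closed closed_Times) (auto simp: slab_def intro!: compact_Times)
    show "slab c b \<inter> ((- ball 0 1) \<times> UNIV) \<subseteq> (- ball 0 1) \<times> {..T}"
      using T by (auto simp: slab_def)
    show "?w p = 0" if p: "p \<notin> slab c b \<inter> ((- ball 0 1) \<times> UNIV)" for p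
    proof (cases "p \<in> slab c b")
      case True
      then have "norm (fst p) < 1" using p by (cases p) auto
      then show ?thesis using mu c \<phi> by (intro elastic_adjoint_plane_wave) auto
    next
      case False
      then show ?thesis using w closure_subset[of "{x. ?w x \<noteq> 0}"]
        by (auto simp: Cc_inf_def fsupport_def)
    qed
  qed
  then show ?thesis using u(2)[of j] by (simp add: vanishes_on_def)
qed

lemma wave_operator_adjoint:
  fixes u :: "3 \<Rightarrow> spacetime functional"
  assumes u: "\<And>m. distribution (u m)" and F: "F \<in> Cc_inf UNIV"
  shows "(\<Sum>i\<in>UNIV. \<beta> $ i * (D_t (D_t (u i)) F
              - (lam + mu) * D_x i (\<lambda>f. \<Sum>j\<in>UNIV. D_x j (u j) f) F
              - mu * (\<Sum>j\<in>UNIV. D_x j (D_x j (u i)) F)))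
       = (\<Sum>j\<in>UNIV. u j (elastic_adjoint lam mu \<beta> j F))"
proof -
  have u_adj: "u j (elastic_adjoint lam mu \<beta> j F) = \<beta> $ j * u j (dt (dt F))
     - (lam + mu) * (\<Sum>i\<in>UNIV. \<beta> $ i * u j (dx j (dx i F))) - mu * \<beta> $ j * (\<Sum>k\<in>UNIV. u j (dx k (dx k F)))" for j
  proof -
    let ?A = "\<lambda>p. \<beta> $ j * dt (dt F) p + (- (lam + mu)) * (\<Sum>i\<in>UNIV. \<beta> $ i * dx j (dx i F) p)"
    let ?B = "\<lambda>p. \<Sum>k\<in>UNIV. dx k (dx k F) p"
    have A: "?A \<in> Cc_inf UNIV" and B: "?B \<in> Cc_inf UNIV"
      by (intro Cc_inf_add Cc_inf_scale Cc_inf_sum Cc_inf_dderiv F)+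
    have "u j (elastic_adjoint lam mu \<beta> j F) = u j (\<lambda>p. 1 * ?A p + (- mu * \<beta> $ j) * ?B p)"
      by (simp add: elastic_adjoint_def[abs_def])
    also have "\<dots> = 1 * u j ?A + (- mu * \<beta> $ j) * u j ?B"
      by (rule distribution_lin[OF u A B])
    also have "u j ?B = (\<Sum>k\<in>UNIV. u j (dx k (dx k F)))"
      by (rule distribution_sum[OF u]) (auto intro!: Cc_inf_dderiv F)
    also have "u j ?A = \<beta> $ j * u j (dt (dt F)) + (- (lam + mu)) * u j (\<lambda>p. \<Sum>i\<in>UNIV. \<beta> $ i * dx j (dx i F) p)"
      by (rule distribution_lin[OF u]) (intro Cc_inf_scale Cc_inf_sum Cc_inf_dderiv F)+
    also have "u j (\<lambda>p. \<Sum>i\<in>UNIV. \<beta> $ i * dx j (dx i F) p) = (\<Sum>i\<in>UNIV. u j (\<lambda>p. \<beta> $ i * dx j (dx i F) p))"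
      by (rule distribution_sum[OF u]) (auto intro!: Cc_inf_dderiv Cc_inf_scale F)
    also have "\<dots> = (\<Sum>i\<in>UNIV. \<beta> $ i * u j (dx j (dx i F)))"
      by (intro sum.cong refl distribution_scale u Cc_inf_dderiv F)
    finally show ?thesis by (simp add: algebra_simps)
  qed
  have "(\<Sum>i\<in>UNIV. \<beta> $ i * (\<Sum>j\<in>UNIV. u j (dx j (dx i F)))) = (\<Sum>j\<in>UNIV. \<Sum>i\<in>UNIV. \<beta> $ i * u j (dx j (dx i F)))"
    unfolding sum_distrib_left by (rule sum.swap)
  moreover have "(\<Sum>i\<in>UNIV. \<beta> $ i * ((lam + mu) * S i)) = (lam + mu) * (\<Sum>i\<in>UNIV. \<beta> $ i * S i)" for S
    by (simp add: sum_distrib_left mult.left_commute)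
  ultimately show ?thesis
    unfolding u_adj dist_deriv_def
    by (simp add: sum_subtractf sum.distrib sum_negf right_diff_distrib mult.assoc sum_distrib_left[symmetric] mult.left_commute)
qed

section \<open>Integration against a wave front\<close>

lemma lborel_integral_shift:
  fixes f :: "'a::euclidean_space \<Rightarrow> real"
  assumes "f \<in> borel_measurable borel"
  shows "(\<integral>x. f (x + v) \<partial>lborel) = (\<integral>x. f x \<partial>lborel)"
proof -
  have "(\<integral>x. f x \<partial>lborel) = (\<integral>x. f x \<partial>distr lborel borel ((+) v))"
    by (simp add: lborel_distr_plus)
  also have "\<dots> = (\<integral>x. f (v + x) \<partial>lborel)"
    using assms by (subst integral_distr) auto
  finally show ?thesis by (simp add: add.commute)
qed

lemma has_derivative_along_line:
  assumes "G differentiable (at (p + s *\<^sub>R v))"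
  shows "((\<lambda>s. G (p + s *\<^sub>R v)) has_real_derivative dderiv v G (p + s *\<^sub>R v)) (at s)"
proof -
  let ?L = "\<lambda>w. dderiv w G (p + s *\<^sub>R v)"
  have L: "(G has_derivative ?L) (at (p + s *\<^sub>R v))"
    by (rule has_derivative_dderiv[OF assms])
  have "((\<lambda>s. p + s *\<^sub>R v) has_derivative (\<lambda>h. h *\<^sub>R v)) (at s)"
    by (auto intro!: derivative_eq_intros)
  from has_derivative_compose[OF this L]
  have "((\<lambda>s. G (p + s *\<^sub>R v)) has_derivative (\<lambda>h. ?L (h *\<^sub>R v))) (at s)" .
  moreover have "(\<lambda>h. ?L (h *\<^sub>R v)) = (\<lambda>h. ?L v * h)"
    using linear_cmul[OF has_derivative_linear[OF L]] by (simp add: mult.commute fun_eq_iff)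
  ultimately show ?thesis by (simp add: has_field_derivative_def)
qed

text \<open>Averaging the integral over the translates of \<open>G\<close> by \<open>s v\<close> with \<open>0 \<le> s \<le> 1\<close> does not change it,
because \<open>A\<close> is invariant. By Fubini and the fundamental theorem of calculus the average is the
difference of the integrals of \<open>G(p + v)\<close> and \<open>G(p)\<close> over \<open>A\<close>, which is zero for the same reason.\<close>

lemma integral_derivative_along_invariant_direction:
  fixes A :: "'a::euclidean_space set"
  assumes A: "A \<in> sets borel" and inv: "\<And>p s. p + s *\<^sub>R v \<in> A \<longleftrightarrow> p \<in> A"
    and G: "G \<in> Cc_inf UNIV"
  shows "(\<integral>p. indicator A p * dderiv v G p \<partial>lborel) = 0"
proof -
  obtain S where S: "smooth G" "compact S" "\<And>x. x \<notin> S \<Longrightarrow> G x = 0"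
    by (rule Cc_infE[OF G]) (rule that, assumption, assumption, simp)
  define g where "g = dderiv v G"
  have g: "continuous_on UNIV g" "\<And>x. x \<notin> S \<Longrightarrow> g x = 0"
    using S by (auto simp: g_def intro!: smooth_continuous smooth_dderiv dderiv_outside_support compact_imp_closed)
  have [measurable]: "g \<in> borel_measurable borel" "G \<in> borel_measurable borel"
    using g(1) smooth_continuous[OF S(1), of UNIV] by (auto intro: borel_measurable_continuous_onI)
  note A[measurable]
  define \<Phi> where "\<Phi> = (\<lambda>s p. indicator {0..1::real} s * (indicator A p * g (p + s *\<^sub>R v)))"
  \<comment> \<open>the points whose translate by some \<open>s v\<close> with \<open>0 \<le> s \<le> 1\<close> meets the support\<close>
  define S' where "S' = (\<lambda>(s, x). x - s *\<^sub>R v) ` ({0..1::real} \<times> S)"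
  have S': "compact S'"
    unfolding S'_def using S(2) 
    by (intro compact_continuous_image compact_Times) (auto intro!: continuous_intros simp: case_prod_beta)
  have int: "integrable (lborel \<Otimes>\<^sub>M lborel) (\<lambda>(s, p). \<Phi> s p)"
  proof -
    have *: "integrable lborel (\<lambda>z. indicator ({0..1} \<times> S') z *\<^sub>R g (snd z + fst z *\<^sub>R v))"
      using S' by (intro borel_integrable_compact compact_Times continuous_on_compose2[OF g(1)] continuous_intros) auto
    then have "integrable lborel (\<lambda>z. indicator ({0..1::real} \<times> A) z *\<^sub>R indicator ({0..1} \<times> S') z *\<^sub>R g (snd z + fst z *\<^sub>R v))"
      using A by (intro integrable_mult_indicator[OF _ *]) (simp add: borel_Times)
    moreover have "indicator ({0..1::real} \<times> A) z *\<^sub>R indicator ({0..1} \<times> S') z *\<^sub>R g (snd z + fst z *\<^sub>R v)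
        = (case z of (s, p) \<Rightarrow> \<Phi> s p)" for z
    proof (cases z)
      case (Pair s p)
      have "p \<in> S'" if "s \<in> {0..1}" "g (p + s *\<^sub>R v) \<noteq> 0"
      proof -
        have "p + s *\<^sub>R v \<in> S" using that g(2) by blast
        then show ?thesis
          unfolding S'_def using that(1) by (intro image_eqI[of _ _ "(s, p + s *\<^sub>R v)"]) auto
      qed
      then show ?thesis by (auto simp: Pair \<Phi>_def indicator_def)
    qed
    ultimately show ?thesis by (simp add: lborel_prod)
  qed
  define I where "I = (\<integral>p. indicator A p * g p \<partial>lborel)"
  have i1: "(\<integral>p. \<Phi> s p \<partial>lborel) = indicator {0..1} s * I" for s
  proof -
    have "(\<integral>p. indicator A p * g (p + s *\<^sub>R v) \<partial>lborel) = (\<integral>p. indicator A (p + s *\<^sub>R v) * g (p + s *\<^sub>R v) \<partial>lborel)"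
      by (simp add: indicator_def inv)
    also have "\<dots> = I" unfolding I_def
      by (rule lborel_integral_shift) measurable
    finally show ?thesis by (simp add: \<Phi>_def)
  qed
  have i2: "(\<integral>s. \<Phi> s p \<partial>lborel) = indicator A p * (G (p + v) - G p)" for p
  proof -
    have "(\<integral>s. g (p + s *\<^sub>R v) * indicator {0..1} s \<partial>lborel) = G (p + 1 *\<^sub>R v) - G (p + 0 *\<^sub>R v)"
    proof (rule integral_FTC_Icc_real)
      show "((\<lambda>s. G (p + s *\<^sub>R v)) has_real_derivative g (p + s *\<^sub>R v)) (at s)" for s
        unfolding g_def by (intro has_derivative_along_line smooth_differentiable S(1))
      have "continuous_on UNIV (\<lambda>s. g (p + s *\<^sub>R v))"
        by (rule continuous_on_compose2[OF g(1)]) (auto intro!: continuous_intros)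
      then show "isCont (\<lambda>s. g (p + s *\<^sub>R v)) s" for s
        by (simp add: continuous_on_eq_continuous_at)
    qed simp
    moreover have "(\<integral>s. \<Phi> s p \<partial>lborel) = (\<integral>s. indicator A p * (g (p + s *\<^sub>R v) * indicator {0..1} s) \<partial>lborel)"
      by (simp add: \<Phi>_def mult_ac)
    ultimately show ?thesis by simp
  qed
  have intG: "integrable lborel (\<lambda>p. indicator A p * G p)"
    using integrable_mult_indicator[of A lborel G] A Cc_inf_integrable[OF G] by simp
  have "I = (\<integral>s. indicator {0..1::real} s * I \<partial>lborel)"
    by simp
  also have "\<dots> = (\<integral>s. (\<integral>p. \<Phi> s p \<partial>lborel) \<partial>lborel)"
    by (simp add: i1)
  also have "\<dots> = (\<integral>p. (\<integral>s. \<Phi> s p \<partial>lborel) \<partial>lborel)"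
    using lborel_pair.Fubini_integral[OF int] by simp
  also have "\<dots> = (\<integral>p. indicator A (p + v) * G (p + v) - indicator A p * G p \<partial>lborel)"
    using inv[of _ 1] by (simp add: i2 indicator_def if_distrib right_diff_distrib cong: if_cong)
  also have "\<dots> = (\<integral>p. indicator A (p + v) * G (p + v) \<partial>lborel) - (\<integral>p. indicator A p * G p \<partial>lborel)"
  proof (rule Bochner_Integration.integral_diff[OF _ intG])
    have "integrable (distr lborel borel ((+) v)) (\<lambda>p. indicator A p * G p)"
      using intG by (simp add: lborel_distr_plus)
    then show "integrable lborel (\<lambda>p. indicator A (p + v) * G (p + v))"
      by (subst (asm) integrable_distr_eq) (auto simp: add.commute)
  qed
  also have "\<dots> = 0"
    using lborel_integral_shift[of "\<lambda>p. indicator A p * G p" v] by simp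
  finally show ?thesis by (simp add: I_def g_def)
qed

definition behind_front :: "real \<Rightarrow> real^3 \<Rightarrow> spacetime set" where
  "behind_front c \<theta> = {p. 0 \<le> c * snd p - \<theta> \<bullet> fst p}"

lemma heaviside_front: "heaviside (c * t - \<theta> \<bullet> x) = indicator (behind_front c \<theta>) (x, t)"
  by (auto simp: heaviside_def behind_front_def)

lemma behind_front_borel: "behind_front c \<theta> \<in> sets borel"
  unfolding behind_front_def
  by (intro borel_closed closed_Collect_le continuous_intros)

text \<open>For fixed \<open>x\<close> the set \<open>behind_front c \<theta>\<close> is the half-line of times after \<open>(\<theta> \<bullet> x) / c\<close>, and the
fundamental theorem of calculus leaves the value at its end point.\<close>

lemma integral_front_time_derivative:
  assumes c: "c > 0" and G: "G \<in> Cc_inf UNIV"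
  shows "(\<integral>p. indicator (behind_front c \<theta>) p * dderiv (0, 1) G p \<partial>lborel)
       = - (\<integral>x. G (x, \<theta> \<bullet> x / c) \<partial>lborel)"
proof -
  let ?A = "behind_front c \<theta>"
  obtain S where S: "smooth G" "compact S" "\<And>x. x \<notin> S \<Longrightarrow> G x = 0"
    by (rule Cc_infE[OF G]) (rule that, assumption, assumption, simp)
  define g where "g = dderiv (0, 1) G"
  have g: "continuous_on UNIV g" "g \<in> Cc_inf UNIV"
    using S G by (auto simp: g_def intro!: smooth_continuous smooth_dderiv Cc_inf_dderiv)
  obtain M where M: "\<And>p. p \<in> S \<Longrightarrow> norm p \<le> M"
    using compact_imp_bounded[OF S(2)] by (auto simp: bounded_iff)
  have int: "integrable (lborel \<Otimes>\<^sub>M lborel) (\<lambda>p. indicator ?A p * g p)"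
    using integrable_mult_indicator[of ?A lborel g] behind_front_borel Cc_inf_integrable[OF g(2)]
    by (simp add: lborel_prod)
  have inner: "(\<integral>t. indicator ?A (x, t) * g (x, t) \<partial>lborel) = - G (x, \<theta> \<bullet> x / c)" for x
  proof -
    define a where "a = \<theta> \<bullet> x / c"
    \<comment> \<open>any time after the front has passed and \<open>G\<close> has died out\<close>
    define b where "b = max a (\<bar>M\<bar> + 1)"
    have out: "(x, t) \<notin> S" if "t \<ge> b" for t
    proof
      assume "(x, t) \<in> S"
      then have "norm (x, t) \<le> M" by (rule M)
      moreover have "\<bar>t\<bar> \<le> norm (x, t)" using norm_snd_le[of t x] by simp
      ultimately show False using that by (auto simp: b_def)
    qed
    then have zero: "G (x, t) = 0" if "t \<ge> b" for t using that S(3) by blast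
    have zero': "g (x, t) = 0" if "t \<ge> b" for t
      unfolding g_def using out that S by (intro dderiv_outside_support[of S]) (auto intro: compact_imp_closed)
    have "(\<integral>t. indicator ?A (x, t) * g (x, t) \<partial>lborel) = (\<integral>t. g (x, t) * indicator {a..b} t \<partial>lborel)"
    proof (rule Bochner_Integration.integral_cong[OF refl])
      fix t
      have "(x, t) \<in> ?A \<longleftrightarrow> a \<le> t" using c by (simp add: behind_front_def a_def field_simps)
      then show "indicator ?A (x, t) * g (x, t) = g (x, t) * indicator {a..b} t"
        using zero'[of t] by (auto simp: indicator_def)
    qed
    also have "\<dots> = G (x, b) - G (x, a)"
    proof (rule integral_FTC_Icc_real)
      show "((\<lambda>t. G (x, t)) has_real_derivative g (x, t)) (at t)" for t
        using has_derivative_along_line[of G "(x, 0)" t "(0, 1)"] smooth_differentiable[OF S(1)]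
        by (simp add: g_def)
      show "isCont (\<lambda>t. g (x, t)) t" for t
      proof -
        have "continuous_on UNIV (\<lambda>t. g (x, t))"
          by (rule continuous_on_compose2[OF g(1)]) (auto intro!: continuous_intros)
        then show ?thesis by (simp add: continuous_on_eq_continuous_at)
      qed
    qed (simp add: b_def)
    finally show ?thesis using zero[of b] by (simp add: a_def)
  qed
  have "(\<integral>p. indicator ?A p * g p \<partial>lborel) = (\<integral>p. indicator ?A p * g p \<partial>(lborel \<Otimes>\<^sub>M lborel))"
    by (simp add: lborel_prod)
  also have "\<dots> = (\<integral>x. (\<integral>t. indicator ?A (x, t) * g (x, t) \<partial>lborel) \<partial>lborel)"
    by (rule lborel_pair.integral_fst'[OF int, symmetric])
  also have "\<dots> = (\<integral>x. - G (x, \<theta> \<bullet> x / c) \<partial>lborel)"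
    by (simp only: inner)
  finally show ?thesis by (simp add: g_def)
qed

lemma dderiv_linear: 
  assumes "f differentiable (at x)"
  shows "dderiv (v + s *\<^sub>R w) f x = dderiv v f x + s * dderiv w f x"
proof -
  have L: "linear (\<lambda>v. dderiv v f x)"
    using has_derivative_linear[OF has_derivative_dderiv[OF assms]] .
  show ?thesis
    using linear_add[OF L, of v "s *\<^sub>R w"] linear_cmul[OF L, of s w] by simp
qed

text \<open>The vector \<open>(e\<^sub>k, \<theta>\<^sub>k / c)\<close> is tangential to the front, so the derivative in this direction integrates to zero
and the space derivative reduces to the time derivative.\<close>

lemma integral_front_space_derivative:
  assumes c: "c > 0" and G: "G \<in> Cc_inf UNIV"
  shows "(\<integral>p. indicator (behind_front c \<theta>) p * dx k G p \<partial>lborel)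
       = \<theta> $ k / c * (\<integral>x. G (x, \<theta> \<bullet> x / c) \<partial>lborel)"
proof -
  let ?A = "behind_front c \<theta>"
  let ?v = "(axis k 1, 0) + (\<theta> $ k / c) *\<^sub>R (0, 1) :: spacetime"
  have int: "integrable lborel (\<lambda>p. indicator ?A p * dderiv v G p)" for v
    using integrable_mult_indicator[of ?A lborel "dderiv v G"] behind_front_borel
      Cc_inf_integrable[OF Cc_inf_dderiv[OF G]] by simp
  have inv: "p + s *\<^sub>R ?v \<in> ?A \<longleftrightarrow> p \<in> ?A" for p s
    using c by (cases p) (simp add: behind_front_def inner_add_right inner_axis algebra_simps)
  have "dderiv ?v G p = dx k G p + \<theta> $ k / c * dt G p" for p
    using G by (intro dderiv_linear smooth_differentiable) (auto simp: Cc_inf_def)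
  then have "0 = (\<integral>p. indicator ?A p * dx k G p + \<theta> $ k / c * (indicator ?A p * dt G p) \<partial>lborel)"
    using integral_derivative_along_invariant_direction[OF behind_front_borel inv G]
    by (simp add: distrib_left mult.left_commute)
  also have "\<dots> = (\<integral>p. indicator ?A p * dx k G p \<partial>lborel) + \<theta> $ k / c * (\<integral>p. indicator ?A p * dt G p \<partial>lborel)"
    using int by simp
  finally show ?thesis
    using integral_front_time_derivative[OF c G, of \<theta>] by simp
qed

definition wave_speed :: "real \<Rightarrow> real \<Rightarrow> 3 \<Rightarrow> 3 \<Rightarrow> real" where
  "wave_speed lam mu a b = (if a = b then c_p lam mu else c_s mu)"

lemma incident_wave_axis:
  "incident_wave lam mu (axis a 1) (axis b 1) p $ l =
     (if l = b then indicator (behind_front (wave_speed lam mu a b) (axis a 1)) p else 0)"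
proof (cases p)
  case (Pair x t)
  have "axis b (1::real) = (axis a 1 :: real^3) \<longleftrightarrow> a = b" by (auto simp: axis_eq_axis)
  moreover have "(axis b 1 :: real^3) $ l = (if l = b then 1 else 0)" by (simp add: axis_def)
  ultimately show ?thesis
    unfolding Pair incident_wave_def case_prod_conv wave_speed_def
    by (cases "a = b") (simp_all add: heaviside_front)
qed

section \<open>The source tested by plane waves\<close>

definition contract :: "(3 \<Rightarrow> 3 \<Rightarrow> 3 \<Rightarrow> 3 \<Rightarrow> real) \<Rightarrow> real^3 \<Rightarrow> real^3 \<Rightarrow> 3 \<Rightarrow> 3 \<Rightarrow> real" where
  "contract X \<beta> \<omega> a b = (\<Sum>i\<in>UNIV. \<Sum>j\<in>UNIV. \<beta> $ i * \<omega> $ j * X i j a b)"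

definition laplace :: "(real^3 \<Rightarrow> real) \<Rightarrow> real^3 \<Rightarrow> real" where
  "laplace f \<xi> = (\<integral>x. f x * exp (\<xi> \<bullet> x) \<partial>lborel)"

text \<open>A primitive of \<open>exp (\<kappa> s)\<close>, truncated so that it is unchanged on the interval from \<open>- L\<close> to \<open>L\<close>.\<close>

definition exp_profile :: "real \<Rightarrow> real \<Rightarrow> real \<Rightarrow> real" where
  "exp_profile L \<kappa> s = cutoff (L * L) ((L + 1) * (L + 1)) (s * s) * (inverse \<kappa> * exp (\<kappa> * s))"

lemma smooth_exp_profile: 
  assumes "L > 0" shows "smooth (exp_profile L \<kappa>)"
proof -
  have id: "smooth (\<lambda>s::real. s)" by (intro smooth_linear linear_id[unfolded id_def])
  have "L * L < (L + 1) * (L + 1)" using assms by (simp add: algebra_simps)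
  then have "smooth (\<lambda>s. cutoff (L * L) ((L + 1) * (L + 1)) (s * s))"
    by (intro smooth_compose_real[OF smooth_cutoff smooth_mult[OF id id]])
  then show ?thesis
    unfolding exp_profile_def[abs_def] by (intro smooth_mult smooth_const smooth_exp)
qed

lemma exp_profile_zero:
  assumes "L > 0" "\<bar>s\<bar> \<ge> L + 1" shows "exp_profile L \<kappa> s = 0"
proof -
  have "(L + 1) * (L + 1) \<le> \<bar>s\<bar> * \<bar>s\<bar>" using assms by (intro mult_mono) auto
  then show ?thesis by (simp add: exp_profile_def cutoff_zero)
qed

lemma dderiv_exp_profile:
  assumes "L > 0" "\<kappa> \<noteq> 0" "\<bar>s\<bar> < L"
  shows "dderiv 1 (exp_profile L \<kappa>) s = exp (\<kappa> * s)"
proof -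
  have D: "((\<lambda>s. inverse \<kappa> * exp (\<kappa> * s)) has_derivative (\<lambda>v. exp (\<kappa> * s) * v)) (at s)"
    using assms by (auto intro!: derivative_eq_intros)
  have "dderiv 1 (exp_profile L \<kappa>) s = dderiv 1 (\<lambda>s. inverse \<kappa> * exp (\<kappa> * s)) s"
  proof (rule dderiv_transform_open[of "{- L <..< L}"])
    show "exp_profile L \<kappa> y = inverse \<kappa> * exp (\<kappa> * y)" if "y \<in> {- L <..< L}" for y
    proof -
      have "\<bar>y\<bar> * \<bar>y\<bar> \<le> L * L" using that by (intro mult_mono) auto
      moreover have "L * L < (L + 1) * (L + 1)" using assms by (simp add: algebra_simps)
      ultimately show ?thesis by (simp add: exp_profile_def cutoff_one)
    qed
    show "(\<lambda>s. inverse \<kappa> * exp (\<kappa> * s)) differentiable at s"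
      using D by (auto simp: differentiable_def)
  qed (use assms in auto)
  also have "\<dots> = exp (\<kappa> * s)" using dderiv_eqI[OF D, of 1] by simp
  finally show ?thesis .
qed

lemma Cc_inf_ball_zero: "f \<in> Cc_inf (ball 0 1) \<Longrightarrow> \<not> norm x < 1 \<Longrightarrow> f x = 0"
  using closure_subset[of "{x. f x \<noteq> 0}"] by (force simp: Cc_inf_def fsupport_def)

text \<open>Integration by parts moves all derivatives of the source to the test field, and the Heaviside
function turns the space-time integral into an integral over the front \<open>t = (\<theta> \<bullet> x) / c\<close>. On the front the
phase of the test wave is \<open>((c' / c) \<theta> - \<omega>) \<bullet> x\<close>, of modulus less than \<open>c' / c + 1\<close> in the unit ball, so the
truncation of the exponential profile at \<open>L\<close> is invisible.\<close>

lemma scattering_identity: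
  fixes C :: "3 \<Rightarrow> 3 \<Rightarrow> 3 \<Rightarrow> 3 \<Rightarrow> real^3 \<Rightarrow> real"
  assumes mu: "mu > 0" "lam + 2 * mu > 0"
    and \<rho>: "\<rho> \<in> Cc_inf (ball 0 1)" and C: "\<And>i j k l. C i j k l \<in> Cc_inf (ball 0 1)"
    and u: "linearized_scattered_wave lam mu C \<rho> (axis a 1) (axis b 1) u"
    and van: "\<And>m. vanishes_on (u m) ((- ball 0 1) \<times> {..T})"
    and c': "c' > 0" "admissible lam mu c' \<omega> \<beta>"
    and L: "L \<ge> c' / wave_speed lam mu a b + 1" and T: "(L + 3) / c' \<le> T"
    and \<kappa>: "\<kappa> \<noteq> 0" and \<xi>: "\<xi> = \<kappa> *\<^sub>R ((c' / wave_speed lam mu a b) *\<^sub>R axis a 1 - \<omega>)"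
  shows "contract (\<lambda>i j k l. laplace (C i j k l) \<xi>) \<beta> \<omega> a b
     = wave_speed lam mu a b * c' * \<beta> $ b * laplace \<rho> \<xi>"
proof -
  let ?c = "wave_speed lam mu a b" and ?\<theta> = "axis a 1 :: real^3"
  define A where "A = behind_front ?c ?\<theta>"
  define \<phi> where "\<phi> = exp_profile L \<kappa>"
  define F where "F = plane_wave_test c' \<omega> \<phi>"
  have c: "?c > 0" using mu by (simp add: wave_speed_def c_p_def c_s_def)
  have \<omega>: "norm \<omega> = 1" using c' by (simp add: admissible_def)
  have "c' / ?c > 0" using c c' by simp
  then have L0: "L > 0" using L by linarith
  have \<phi>: "smooth \<phi>" "\<And>s. \<bar>s\<bar> \<ge> L + 1 \<Longrightarrow> \<phi> s = 0"
    using L0 by (auto simp: \<phi>_def smooth_exp_profile exp_profile_zero)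
  have F: "F \<in> Cc_inf UNIV"
    using Cc_inf_plane_wave_test[OF c'(1) \<omega> \<phi>] Cc_inf_mono[of _ UNIV] by (auto simp: F_def)
  have front: "dderiv 1 \<phi> (phase c' \<omega> (x, ?\<theta> \<bullet> x / ?c)) = exp (\<xi> \<bullet> x)" if x: "norm x < 1" for x
  proof -
    let ?s = "phase c' \<omega> (x, ?\<theta> \<bullet> x / ?c)"
    have "\<bar>?\<theta> \<bullet> x\<bar> < 1" "\<bar>\<omega> \<bullet> x\<bar> \<le> 1"
      using Cauchy_Schwarz_ineq2[of ?\<theta> x] Cauchy_Schwarz_ineq2[of \<omega> x] \<omega> x by auto
    moreover have "\<bar>q * z\<bar> < q" if "q > 0" "\<bar>z\<bar> < 1" for q z :: real
      using that by (simp add: abs_mult)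
    ultimately have "\<bar>c' / ?c * (?\<theta> \<bullet> x)\<bar> < c' / ?c" using \<open>c' / ?c > 0\<close> by blast
    moreover have "?s = c' / ?c * (?\<theta> \<bullet> x) - \<omega> \<bullet> x" by (simp add: phase_def)
    ultimately have "\<bar>?s\<bar> < L" using L \<open>\<bar>\<omega> \<bullet> x\<bar> \<le> 1\<close> by linarith
    then have "dderiv 1 \<phi> ?s = exp (\<kappa> * ?s)"
      unfolding \<phi>_def using L0 \<kappa> by (intro dderiv_exp_profile)
    also have "\<kappa> * ?s = \<xi> \<bullet> x"
      by (simp add: \<xi> phase_def inner_diff_left)
    finally show ?thesis .
  qed
  have dF: "g x * dderiv v F (x, ?\<theta> \<bullet> x / ?c) = phase c' \<omega> v * (g x * exp (\<xi> \<bullet> x))"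
    if "g \<in> Cc_inf (ball 0 1)" for g x v
  proof (cases "norm x < 1")
    case True
    then show ?thesis
      using front dderiv_plane_wave_test[OF \<phi>(1), of "(x, ?\<theta> \<bullet> x / ?c)" v c' \<omega>] by (simp add: F_def)
  qed (simp add: Cc_inf_ball_zero[OF that])
  have smooth_ext: "smooth (\<lambda>p::spacetime. g (fst p))" if "g \<in> Cc_inf (ball 0 1)" for g :: "real^3 \<Rightarrow> real"
    using that by (intro smooth_fst) (auto simp: Cc_inf_def)
  define u0 where "u0 = (\<lambda>l. dist_of (\<lambda>p. incident_wave lam mu ?\<theta> (axis b 1) p $ l))"
  have u0: "u0 l f = (if l = b then \<integral>p. indicator A p * f p \<partial>lborel else 0)" for l f
    by (simp add: u0_def dist_of_def incident_wave_axis A_def)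
  have stiff: "D_x j (dist_mult (\<lambda>(x, t). C i j k l x) (D_x k (u0 l))) F
      = (if l = b then ?\<theta> $ k / ?c * (- \<omega> $ j * laplace (C i j k l) \<xi>) else 0)" for i j k l
  proof -
    let ?G = "\<lambda>p. C i j k l (fst p) * dx j F p"
    have G: "?G \<in> Cc_inf UNIV"
      by (intro Cc_inf_mult_left smooth_ext C Cc_inf_dderiv F)
    have "D_x j (dist_mult (\<lambda>(x, t). C i j k l x) (D_x k (u0 l))) F = u0 l (dx k ?G)"
      by (simp add: dist_deriv_def dist_mult_def case_prod_beta)
    also have "\<dots> = (if l = b then ?\<theta> $ k / ?c * (\<integral>x. ?G (x, ?\<theta> \<bullet> x / ?c) \<partial>lborel) else 0)"
      unfolding u0 A_def by (simp only: integral_front_space_derivative[OF c G])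
    also have "(\<integral>x. ?G (x, ?\<theta> \<bullet> x / ?c) \<partial>lborel) = - \<omega> $ j * laplace (C i j k l) \<xi>"
      by (simp add: dF[OF C] phase_axis laplace_def)
    finally show ?thesis .
  qed
  have dens: "dist_mult (\<lambda>(x, t). \<rho> x) (D_t (D_t (u0 i))) F = (if i = b then - (c' * laplace \<rho> \<xi>) else 0)" for i
  proof -
    let ?H = "\<lambda>p. \<rho> (fst p) * F p"
    have sF: "smooth F" using F by (simp add: Cc_inf_def)
    have H: "?H \<in> Cc_inf UNIV" by (intro Cc_inf_mult_left smooth_ext \<rho> F)
    have dtH: "dt ?H p = \<rho> (fst p) * dt F p" for p
    proof -
      have d\<rho>: "(\<lambda>p::spacetime. \<rho> (fst p)) differentiable at p"
        by (intro smooth_differentiable smooth_ext \<rho>)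
      have "dt (\<lambda>p::spacetime. \<rho> (fst p)) p = dderiv 0 \<rho> (fst p)"
        using \<rho> by (subst dderiv_fst) (auto simp: Cc_inf_def intro: smooth_differentiable)
      also have "\<dots> = 0"
        using \<rho> linear_0[OF has_derivative_linear[OF has_derivative_dderiv[of \<rho> "fst p"]]]
        by (auto simp: Cc_inf_def intro: smooth_differentiable)
      finally have "dt (\<lambda>p::spacetime. \<rho> (fst p)) p = 0" .
      then show ?thesis
        using dderiv_eqI[OF has_derivative_mult[OF has_derivative_dderiv[OF d\<rho>]
            has_derivative_dderiv[OF smooth_differentiable[OF sF]]], of "(0, 1)"] by simp
    qed
    have "dist_mult (\<lambda>(x, t). \<rho> x) (D_t (D_t (u0 i))) F = u0 i (dt (dt ?H))"
      by (simp add: dist_deriv_def dist_mult_def case_prod_beta)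
    also have "\<dots> = (if i = b then - (\<integral>x. dt ?H (x, ?\<theta> \<bullet> x / ?c) \<partial>lborel) else 0)"
      unfolding u0 A_def by (simp only: integral_front_time_derivative[OF c Cc_inf_dderiv[OF H]])
    also have "(\<integral>x. dt ?H (x, ?\<theta> \<bullet> x / ?c) \<partial>lborel) = c' * laplace \<rho> \<xi>"
      by (simp add: dtH dF[OF \<rho>] phase_time laplace_def)
    finally show ?thesis .
  qed
  have dist: "\<And>m. distribution (u m)"
    and eq: "\<And>i. D_t (D_t (u i)) F - (lam + mu) * D_x i (\<lambda>f. \<Sum>j\<in>UNIV. D_x j (u j) f) F
              - mu * (\<Sum>j\<in>UNIV. D_x j (D_x j (u i)) F)
            = (\<Sum>j\<in>UNIV. \<Sum>k\<in>UNIV. \<Sum>l\<in>UNIV.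
                 D_x j (dist_mult (\<lambda>(x, t). C i j k l x) (D_x k (u0 l))) F)
              - dist_mult (\<lambda>(x, t). \<rho> x) (D_t (D_t (u0 i))) F"
    using u F unfolding linearized_scattered_wave_def Let_def u0_def by blast+
  have rhs: "(\<Sum>j\<in>UNIV. \<Sum>k\<in>UNIV. \<Sum>l\<in>UNIV. D_x j (dist_mult (\<lambda>(x, t). C i j k l x) (D_x k (u0 l))) F)
      = - (\<Sum>j\<in>UNIV. \<omega> $ j * laplace (C i j a b) \<xi>) / ?c" for i
  proof -
    have "(\<Sum>k\<in>UNIV. \<Sum>l\<in>UNIV. D_x j (dist_mult (\<lambda>(x, t). C i j k l x) (D_x k (u0 l))) F)
        = (\<Sum>k\<in>UNIV. if k = a then - \<omega> $ j * laplace (C i j k b) \<xi> / ?c else 0)" for j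
      unfolding stiff by (intro sum.cong refl) (simp add: axis_def)
    then show ?thesis by (simp add: sum_negf sum_divide_distrib)
  qed
  have "u j (elastic_adjoint lam mu \<beta> j F) = 0" for j
    unfolding F_def
  proof (rule elastic_adjoint_vanishing[OF dist van mu c' \<phi>(1)])
    show "(L + 1 + 2) / c' \<le> T" using T by (simp add: add.assoc)
  qed (rule \<phi>(2))
  then have "0 = (\<Sum>j\<in>UNIV. u j (elastic_adjoint lam mu \<beta> j F))"
    by simp
  \<comment> \<open>summing the weak equation over its components, weighted by \<open>\<beta>\<close>, isolates the source\<close>
  also have "\<dots> = (\<Sum>i\<in>UNIV. \<beta> $ i * (- (\<Sum>j\<in>UNIV. \<omega> $ j * laplace (C i j a b) \<xi>) / ?c
      - (if i = b then - (c' * laplace \<rho> \<xi>) else 0)))"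
    unfolding wave_operator_adjoint[OF dist F, symmetric] eq rhs dens ..
  also have "\<dots> = - (\<Sum>i\<in>UNIV. \<beta> $ i * (\<Sum>j\<in>UNIV. \<omega> $ j * laplace (C i j a b) \<xi>)) / ?c
      + \<beta> $ b * (c' * laplace \<rho> \<xi>)"
  proof -
    have split: "\<beta> $ i * (- S / ?c - (if i = b then - m else 0)) = (if i = b then \<beta> $ i * m else 0) - \<beta> $ i * S / ?c"
      for i S m by (simp add: algebra_simps)
    show ?thesis unfolding split by (simp add: sum_subtractf flip: sum_divide_distrib)
  qed
  finally have "(\<Sum>i\<in>UNIV. \<beta> $ i * (\<Sum>j\<in>UNIV. \<omega> $ j * laplace (C i j a b) \<xi>)) = ?c * (\<beta> $ b * (c' * laplace \<rho> \<xi>))"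
    using c by (simp add: field_simps)
  then show ?thesis
    by (simp add: contract_def sum_distrib_left mult_ac)
qed


section \<open>Rigidity of the linear system at a fixed frequency\<close>

definition reflect :: "real^3 \<Rightarrow> real^3 \<Rightarrow> real^3" where
  "reflect \<xi> v = v - (2 * (v \<bullet> \<xi>) / (\<xi> \<bullet> \<xi>)) *\<^sub>R \<xi>"

text \<open>Let \<open>R\<close> be the reflection along \<open>\<xi>\<close>, scaled by \<open>|\<xi>|\<^sup>2\<close> to be polynomial. This is the block of the
second symmetric power of \<open>R\<close> that acts on the off-diagonal entries of symmetric matrices. The entry with
indices \<open>c + 1\<close> and \<open>c + 2\<close> is numbered by \<open>c\<close>; addition in the type \<open>3\<close> is modulo 3.\<close>

definition reflect_minor :: "real^3 \<Rightarrow> real^3^3" where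
  "reflect_minor \<xi> = (let R = (\<lambda>i j. (\<xi> \<bullet> \<xi>) * (if i = j then 1 else 0) - 2 * \<xi> $ i * \<xi> $ j) in
     \<chi> c d. R (c + 1) (d + 1) * R (c + 2) (d + 2) + R (c + 1) (d + 2) * R (c + 2) (d + 1))"

text \<open>The same off-diagonal block of twice the tensor
\<open>(p, q, s, t) \<mapsto> (\<psi>(p, s) \<psi>(q, t) + \<psi>(p, t) \<psi>(q, s)) / 2\<close> with \<open>\<psi>(p, s) = det (p, s, \<xi>)\<close>. This tensor vanishes when \<open>\<xi>\<close> is inserted,
is invariant under the reflection of \<open>p\<close> and \<open>q\<close>, and satisfies all equations for incident P-waves.\<close>

definition incomp_minor :: "real^3 \<Rightarrow> real^3^3" where
  "incomp_minor \<xi> = (\<chi> c d. if c = d then - (\<xi> $ c)\<^sup>2 else \<xi> $ c * \<xi> $ d)"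

text \<open>The conditions on the frequency, in the order in which they are used: all incident axes have a
reflected direction different from themselves; S to S separates the density; the two S-waves into which a P-wave
along an axis converts are not orthogonal (\<open>r\<close> is the ratio of the wave speeds); the final
linear system has only the zero solution.\<close>

definition generic_direction :: "real \<Rightarrow> real^3 \<Rightarrow> bool" where
  "generic_direction r \<xi> \<longleftrightarrow>
     (\<forall>a. \<xi> $ a \<noteq> 0) \<and> (\<xi> $ 1)\<^sup>2 \<noteq> (\<xi> $ 2)\<^sup>2 \<and>
     (\<forall>a. (1 - 2 * r\<^sup>2) * (\<xi> \<bullet> \<xi>) + 2 * r\<^sup>2 * (\<xi> $ a)\<^sup>2 \<noteq> 0) \<and>
     det (reflect_minor \<xi>) \<noteq> 0 \<and>
     (reflect_minor \<xi> ** incomp_minor \<xi>) $ 1 $ 2 \<noteq> (incomp_minor \<xi> ** reflect_minor \<xi>) $ 1 $ 2"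

lemma index3_arith:
  "(1::3) + 1 = 2" "(2::3) + 1 = 3" "(3::3) + 1 = 1"
  "(1::3) + 2 = 3" "(2::3) + 2 = 1" "(3::3) + 2 = 2" "(4::3) = 1" "(5::3) = 2"
  by simp_all

lemma index3_neq: "(1::3) \<noteq> 2" "(1::3) \<noteq> 3" "(2::3) \<noteq> 3" "(2::3) \<noteq> 1" "(3::3) \<noteq> 1" "(3::3) \<noteq> 2"
  by simp_all

lemma inner_3: "x \<bullet> y = x $ 1 * y $ 1 + x $ 2 * y $ 2 + x $ 3 * y $ (3::3)" for x y :: "real^3"
  by (simp add: inner_vec_def sum_3)

lemma contract_add: "contract X (u + v) \<omega> a b = contract X u \<omega> a b + contract X v \<omega> a b"
  and contract_scale: "contract X (s *\<^sub>R u) \<omega> a b = s * contract X u \<omega> a b"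
  and contract_diff: "contract X (u - v) \<omega> a b = contract X u \<omega> a b - contract X v \<omega> a b"
  by (simp_all add: contract_def sum.distrib sum_subtractf sum_distrib_left algebra_simps)

lemma contract_commute:
  assumes "\<And>i j k l. X i j k l = X j i k l"
  shows "contract X u v a b = contract X v u a b"
  unfolding contract_def using assms by (subst sum.swap) (simp add: mult_ac)

lemma contract_axis_left: "contract X (axis i 1) v a b = (\<Sum>j\<in>UNIV. v $ j * X i j a b)"
proof -
  have "contract X (axis i 1) v a b = (\<Sum>k\<in>UNIV. if k = i then \<Sum>j\<in>UNIV. v $ j * X k j a b else 0)"
    unfolding contract_def by (rule sum.cong) (auto simp: axis_def)
  then show ?thesis by simp
qed

lemma contract_axis: "contract X (axis i 1) (axis j 1) a b = X i j a b"
  unfolding contract_axis_left by (simp add: axis_def if_distrib if_distribR cong: if_cong)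

lemma reflect_orthogonal: "\<xi> \<noteq> 0 \<Longrightarrow> reflect \<xi> u \<bullet> reflect \<xi> v = u \<bullet> v"
  by (simp add: reflect_def inner_diff_left inner_diff_right inner_commute field_simps)

lemma generic_direction_open: "open {\<xi>. generic_direction r \<xi>}"
proof -
  have eq: "{\<xi>. generic_direction r \<xi>} = 
     {\<xi>. (\<forall>a. \<xi> $ a \<noteq> 0)} \<inter> {\<xi>. (\<xi> $ 1)\<^sup>2 \<noteq> (\<xi> $ 2)\<^sup>2} \<inter>
     {\<xi>. (\<forall>a. (1 - 2 * r\<^sup>2) * (\<xi> \<bullet> \<xi>) + 2 * r\<^sup>2 * (\<xi> $ a)\<^sup>2 \<noteq> 0)} \<inter>
     {\<xi>. det (reflect_minor \<xi>) \<noteq> 0} \<inter>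
     {\<xi>. (reflect_minor \<xi> ** incomp_minor \<xi>) $ 1 $ 2 \<noteq> (incomp_minor \<xi> ** reflect_minor \<xi>) $ 1 $ 2}"
    by (auto simp: generic_direction_def)
  show ?thesis
    unfolding eq forall_3 Collect_conj_eq det_3
    by (intro open_Int open_Collect_neq)
      (auto intro!: continuous_intros simp: reflect_minor_def incomp_minor_def matrix_matrix_mult_def sum_3 Let_def
         index3_arith index3_neq)
qed

text \<open>The vectors \<open>(5, 4, 1)\<close> and \<open>(5, 4, 2)\<close> satisfy everything that does not involve \<open>r\<close>. Non-orthogonality can fail only for
an axis with \<open>\<xi>\<^sub>a\<^sup>2 < |\<xi>|\<^sup>2 / 3\<close>, by \<open>r\<^sup>2 < 3 / 4\<close>, which leaves the third axis. It fails there for at most one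
value of \<open>\<xi>\<^sub>3\<^sup>2 / |\<xi>|\<^sup>2\<close>, hence for at most one of the two vectors.\<close>

lemma generic_direction_exists:
  assumes "0 < r" "r\<^sup>2 < 3 / 4"
  shows "\<exists>\<xi>. generic_direction r \<xi>"
proof -
  have gen: "generic_direction r \<xi>" if "\<xi> = vector [5, 4, z]" "z = 1 \<or> z = 2"
    "(1 - 2 * r\<^sup>2) * (41 + z\<^sup>2) + 2 * r\<^sup>2 * z\<^sup>2 \<noteq> 0" for \<xi> z
    using that assms
    by (elim disjE)
      (auto simp: generic_direction_def reflect_minor_def incomp_minor_def matrix_matrix_mult_def sum_3 Let_def
         index3_arith index3_neq vector_3 forall_3 det_3 inner_3)
  show ?thesis
  proof (cases "(1 - 2 * r\<^sup>2) * 42 + 2 * r\<^sup>2 = 0")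
    case True
    then have "(1 - 2 * r\<^sup>2) * 45 + 2 * r\<^sup>2 * 4 \<noteq> 0" by simp
    then show ?thesis using gen[OF refl, of 2] by auto
  next
    case False
    then show ?thesis using gen[OF refl, of 1] by auto
  qed
qed

text \<open>Transposing \<open>M E = c B\<close> gives \<open>E M = c B\<close>, so \<open>M E M\<close> equals both \<open>c (M B)\<close> and \<open>c (B M)\<close>.\<close>

lemma commuting_minor_rigidity:
  fixes M E B :: "real^3^3"
  assumes "transpose M = M" "transpose E = E" "transpose B = B"
    and ME: "M ** E = c *\<^sub>R B" and comm: "M ** B \<noteq> B ** M" and det: "det M \<noteq> 0"
  shows "c = 0" "E = 0"
proof -
  have left: "(k *\<^sub>R P) ** Q = k *\<^sub>R (P ** Q)" and right: "P ** (k *\<^sub>R Q) = k *\<^sub>R (P ** Q)"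
    for k and P Q :: "real^3^3"
    by (simp_all add: matrix_matrix_mult_def vec_eq_iff sum_distrib_left mult_ac)
  have "transpose (M ** E) = transpose (c *\<^sub>R B)" by (simp only: ME)
  moreover have "transpose (c *\<^sub>R B) = c *\<^sub>R transpose B"
    by (simp add: transpose_def vec_eq_iff)
  ultimately have EM: "E ** M = c *\<^sub>R B"
    using assms(1-3) by (simp add: matrix_transpose_mul)
  have "c *\<^sub>R (M ** B) = M ** (E ** M)" by (simp only: EM right)
  also have "\<dots> = c *\<^sub>R (B ** M)" by (simp only: matrix_mul_assoc ME left)
  finally show c: "c = 0" using comm by simp
  obtain M' where M': "M' ** M = mat 1"
    using det invertible_det_nz invertible_def by blast
  have "E = M' ** (M ** E)" by (simp only: matrix_mul_assoc M' matrix_mul_lid)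
  also have "\<dots> = 0" by (simp only: ME c) (simp add: matrix_matrix_mult_def vec_eq_iff)
  finally show "E = 0" .
qed

text \<open>The hypotheses say that \<open>w1\<close> and \<open>w2\<close> are eigenvectors of the symmetric form \<open>s\<close>, and eigenvectors with
different eigenvalues would be orthogonal.\<close>

lemma bilinear_eigenvectors:
  fixes s :: "real^3 \<Rightarrow> real^3 \<Rightarrow> real"
  assumes add: "\<And>u v w. s (u + v) w = s u w + s v w"
    and scale: "\<And>c u w. s (c *\<^sub>R u) w = c * s u w"
    and sym: "\<And>u v. s u v = s v u"
    and w1: "w1 \<noteq> 0" "\<And>\<beta>. \<beta> \<bullet> w1 = 0 \<Longrightarrow> s \<beta> w1 = 0"
    and w2: "w2 \<noteq> 0" "\<And>\<beta>. \<beta> \<bullet> w2 = 0 \<Longrightarrow> s \<beta> w2 = 0"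
    and ne: "w1 \<bullet> w2 \<noteq> 0"
  obtains c where "\<And>v. s v w1 = c * (v \<bullet> w1)" "\<And>v. s v w2 = c * (v \<bullet> w2)"
proof -
  have *: "s v w = s w w / (w \<bullet> w) * (v \<bullet> w)"
    if w: "w \<noteq> 0" "\<And>\<beta>. \<beta> \<bullet> w = 0 \<Longrightarrow> s \<beta> w = 0" for v w
  proof -
    let ?\<beta> = "v - ((v \<bullet> w) / (w \<bullet> w)) *\<^sub>R w"
    have "?\<beta> \<bullet> w = 0" using w(1) by (simp add: inner_diff_left)
    then have "s ?\<beta> w = 0" by (rule w(2))
    moreover have "s v w = s (?\<beta> + ((v \<bullet> w) / (w \<bullet> w)) *\<^sub>R w) w" by simp
    ultimately show ?thesis unfolding add scale by simp
  qed
  have "s w1 w1 / (w1 \<bullet> w1) * (w2 \<bullet> w1) = s w2 w2 / (w2 \<bullet> w2) * (w1 \<bullet> w2)"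
    using *[OF w1, of w2] *[OF w2, of w1] sym by metis
  then have "s w1 w1 / (w1 \<bullet> w1) = s w2 w2 / (w2 \<bullet> w2)"
    using ne by (simp only: inner_commute mult_cancel_right) simp
  with that *[OF w1] *[OF w2] show ?thesis by metis
qed


text \<open>For an incident P-wave along \<open>e\<^sub>a\<close> the converted directions are \<open>r e\<^sub>a - y \<xi>\<close>, where \<open>y\<close> is one of the two
roots of the quadratic equation that makes it a unit vector. They span the plane of \<open>e\<^sub>a\<close> and \<open>\<xi>\<close>, and both are
eigenvectors of \<open>X(\<cdot>, \<cdot>, a, a)\<close>. Their inner product is a nonzero multiple of the expression in \<open>generic\<close>, so this plane is
contained in one eigenspace, and \<open>PP\<close> shows that the eigenvalue is zero.\<close>

lemma p_wave_kernel:
  fixes X :: "3 \<Rightarrow> 3 \<Rightarrow> 3 \<Rightarrow> 3 \<Rightarrow> real"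
  assumes sym: "\<And>i j k l. X i j k l = X j i k l"
    and r: "0 < r" "r < 1" and \<xi>: "\<xi> \<noteq> 0"
    and generic: "(1 - 2 * r\<^sup>2) * (\<xi> \<bullet> \<xi>) + 2 * r\<^sup>2 * (\<xi> $ a)\<^sup>2 \<noteq> 0"
    and PP: "contract X (reflect \<xi> (axis a 1)) (reflect \<xi> (axis a 1)) a a = 0"
    and PS: "\<And>y \<beta>. (\<xi> \<bullet> \<xi>) * y\<^sup>2 - 2 * r * \<xi> $ a * y = 1 - r\<^sup>2 \<Longrightarrow>
      \<beta> \<bullet> (r *\<^sub>R axis a 1 - y *\<^sub>R \<xi>) = 0 \<Longrightarrow> contract X \<beta> (r *\<^sub>R axis a 1 - y *\<^sub>R \<xi>) a a = 0"
  shows "contract X v \<xi> a a = 0" "contract X v (axis a 1) a a = 0"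
proof -
  let ?e = "axis a 1 :: real^3" and ?Q = "\<xi> \<bullet> \<xi>"
  let ?s = "\<lambda>u v. contract X u v a a"
  have commute: "contract X u v a b = contract X v u a b" for u v a b
    by (rule contract_commute) (rule sym)
  have Q: "?Q > 0" using \<xi> by simp
  \<comment> \<open>a quarter of the discriminant of the quadratic equation for \<open>y\<close>\<close>
  define D where "D = r\<^sup>2 * (\<xi> $ a)\<^sup>2 + (1 - r\<^sup>2) * ?Q"
  have "1 - r\<^sup>2 > 0" using r by (simp add: power_less_one_iff abs_square_less_1)
  then have D: "D > 0" using Q by (simp add: D_def add_nonneg_pos)
  define y1 where "y1 = (r * \<xi> $ a + sqrt D) / ?Q"
  define y2 where "y2 = (r * \<xi> $ a - sqrt D) / ?Q"
  have sq: "sqrt D * sqrt D = D" using D by simp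
  have y: "?Q * y1\<^sup>2 - 2 * r * \<xi> $ a * y1 = 1 - r\<^sup>2" "?Q * y2\<^sup>2 - 2 * r * \<xi> $ a * y2 = 1 - r\<^sup>2"
    using Q sq by (simp_all add: y1_def y2_def field_simps power2_eq_square) (simp_all add: D_def power2_eq_square algebra_simps)
  have y12: "y1 \<noteq> y2" "y1 + y2 = 2 * r * \<xi> $ a / ?Q" "y1 * y2 = - (1 - r\<^sup>2) / ?Q"
    using Q D sq by (simp_all add: y1_def y2_def field_simps power2_eq_square) (simp_all add: D_def power2_eq_square algebra_simps)
  define w1 where "w1 = r *\<^sub>R ?e - y1 *\<^sub>R \<xi>"
  define w2 where "w2 = r *\<^sub>R ?e - y2 *\<^sub>R \<xi>"
  have ax: "?e \<bullet> \<xi> = \<xi> $ a" "\<xi> \<bullet> ?e = \<xi> $ a" "?e \<bullet> ?e = 1"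
    by (simp_all add: inner_axis inner_axis')
  have n: "w1 \<bullet> w1 = 1" "w2 \<bullet> w2 = 1"
    using y by (simp_all add: w1_def w2_def inner_diff_left inner_diff_right ax algebra_simps power2_eq_square)
  have "w1 \<bullet> w2 = r\<^sup>2 - r * \<xi> $ a * (y1 + y2) + y1 * y2 * ?Q"
    by (simp add: w1_def w2_def inner_diff_left inner_diff_right ax algebra_simps power2_eq_square)
  also have "\<dots> = - ((1 - 2 * r\<^sup>2) * ?Q + 2 * r\<^sup>2 * (\<xi> $ a)\<^sup>2) / ?Q"
    unfolding y12 using Q by (simp add: field_simps power2_eq_square)
  finally have w12: "w1 \<bullet> w2 \<noteq> 0" using generic Q by simp
  obtain c where c: "\<And>v. ?s v w1 = c * (v \<bullet> w1)" "\<And>v. ?s v w2 = c * (v \<bullet> w2)"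
  proof (rule bilinear_eigenvectors[of ?s w1 w2])
    show "w1 \<noteq> 0" "w2 \<noteq> 0" using n by auto
    show "?s \<beta> w1 = 0" if "\<beta> \<bullet> w1 = 0" for \<beta> using PS[OF y(1)] that by (simp add: w1_def)
    show "?s \<beta> w2 = 0" if "\<beta> \<bullet> w2 = 0" for \<beta> using PS[OF y(2)] that by (simp add: w2_def)
    show "?s u v = ?s v u" for u v by (rule commute)
  qed (use w12 that in \<open>auto simp: contract_add contract_scale\<close>)
  have right_diff: "?s v (p - q) = ?s v p - ?s v q" and right_scale: "?s v (k *\<^sub>R p) = k * ?s v p" for v p q k
    by (metis commute contract_diff) (metis commute contract_scale)
  have "w1 - w2 = (y2 - y1) *\<^sub>R \<xi>" by (simp add: w1_def w2_def algebra_simps)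
  then have "(y2 - y1) * ?s v \<xi> = (y2 - y1) * (c * (v \<bullet> \<xi>))" for v
  proof -
    have "(y2 - y1) * ?s v \<xi> = ?s v (w1 - w2)"
      by (simp only: right_scale \<open>w1 - w2 = (y2 - y1) *\<^sub>R \<xi>\<close>)
    also have "\<dots> = c * (v \<bullet> (w1 - w2))"
      by (simp add: right_diff c inner_diff_right right_diff_distrib)
    also have "\<dots> = (y2 - y1) * (c * (v \<bullet> \<xi>))"
      by (simp add: \<open>w1 - w2 = (y2 - y1) *\<^sub>R \<xi>\<close>)
    finally show ?thesis .
  qed
  then have s\<xi>: "?s v \<xi> = c * (v \<bullet> \<xi>)" for v using y12(1) by simp
  have "r * ?s v ?e = r * (c * (v \<bullet> ?e))" for v
    using c(1)[of v] unfolding w1_def right_diff right_scale s\<xi> by (simp add: algebra_simps)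
  then have se: "?s v ?e = c * (v \<bullet> ?e)" for v using r by simp
  have "?s v (reflect \<xi> ?e) = c * (v \<bullet> reflect \<xi> ?e)" for v
    unfolding reflect_def right_diff right_scale s\<xi> se by (simp add: algebra_simps)
  then have "c * (reflect \<xi> ?e \<bullet> reflect \<xi> ?e) = 0" using PP by simp
  then have "c = 0" using reflect_orthogonal[OF \<xi>, of ?e ?e] by (simp add: ax)
  then show "contract X v \<xi> a a = 0" "contract X v (axis a 1) a a = 0"
    using s\<xi> se by simp_all
qed

text \<open>By \<open>p_wave_kernel\<close> the matrix \<open>X(\<cdot>, \<cdot>, a, a)\<close> annihilates \<open>e\<^sub>a\<close> and \<open>\<xi>\<close>, so it is a multiple of
\<open>w w\<^sup>T\<close> with \<open>w = e\<^sub>a \<times> \<xi>\<close>. Comparing \<open>X\<^sub>a\<^sub>a\<^sub>b\<^sub>b\<close> with \<open>X\<^sub>b\<^sub>b\<^sub>a\<^sub>a\<close> shows that the factor \<open>t\<close> is the same for all three axes.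
Subtracting the tensor of \<open>incomp_minor\<close> with this factor leaves the six components \<open>X\<^sub>p\<^sub>q\<^sub>a\<^sub>b\<close> with \<open>p \<noteq> q\<close> and \<open>a \<noteq> b\<close>, to which
the S to S equations apply.\<close>

lemma tensor_rigidity:
  fixes X :: "3 \<Rightarrow> 3 \<Rightarrow> 3 \<Rightarrow> 3 \<Rightarrow> real"
  assumes sym: "\<And>i j k l. X i j k l = X j i k l" "\<And>i j k l. X i j k l = X k l i j"
    and r: "0 < r" "r < 1" and gen: "generic_direction r \<xi>"
    and PP: "\<And>a. contract X (reflect \<xi> (axis a 1)) (reflect \<xi> (axis a 1)) a a = 0"
    and PS: "\<And>a y \<beta>. (\<xi> \<bullet> \<xi>) * y\<^sup>2 - 2 * r * \<xi> $ a * y = 1 - r\<^sup>2 \<Longrightarrow>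
      \<beta> \<bullet> (r *\<^sub>R axis a 1 - y *\<^sub>R \<xi>) = 0 \<Longrightarrow> contract X \<beta> (r *\<^sub>R axis a 1 - y *\<^sub>R \<xi>) a a = 0"
    and SS: "\<And>a b p q. a \<noteq> b \<Longrightarrow> p \<noteq> q \<Longrightarrow> contract X (reflect \<xi> (axis p 1)) (reflect \<xi> (axis q 1)) a b = 0"
  shows "X i j k l = 0"
proof -
  have \<xi>: "\<xi> $ a \<noteq> 0" for a using gen by (simp add: generic_direction_def)
  have \<xi>0: "\<xi> \<noteq> 0" using \<xi>[of 1] by auto
  let ?Q = "\<xi> \<bullet> \<xi>"
  have Q: "?Q > 0" using \<xi>0 by simp
  have g: "(1 - 2 * r\<^sup>2) * (\<xi> \<bullet> \<xi>) + 2 * r\<^sup>2 * (\<xi> $ a)\<^sup>2 \<noteq> 0" for a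
    using gen by (simp add: generic_direction_def)
  have K: "contract X v \<xi> a a = 0" "contract X v (axis a 1) a a = 0" for v a
    by (rule p_wave_kernel[of X r \<xi> a, OF sym(1) r \<xi>0 g PP PS]; assumption)+
  have aaa: "X i a a a = 0" for i a
    using K(2)[of "axis i 1" a] by (simp add: contract_axis)
  have ker: "(\<Sum>j\<in>UNIV. \<xi> $ j * X i j a a) = 0" for i a
    using K(1)[of "axis i 1" a] by (simp add: contract_axis_left)
  have sl: "X i j k l = X i j l k" for i j k l
    using sym by metis
  \<comment> \<open>rewrite rules to a fixed representative of each orbit of the index symmetries; \<open>z\<close> lists the components that vanish because of \<open>aaa\<close>\<close>
  have nf: "X 2 1 k l = X 1 2 k l" "X 3 1 k l = X 1 3 k l" "X 3 2 k l = X 2 3 k l"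
    "X k l 2 1 = X k l 1 2" "X k l 3 1 = X k l 1 3" "X k l 3 2 = X k l 2 3" 
    "X 2 2 1 1 = X 1 1 2 2" "X 3 3 1 1 = X 1 1 3 3" "X 3 3 2 2 = X 2 2 3 3" 
    "X 1 1 2 3 = X 2 3 1 1" "X 2 2 1 3 = X 1 3 2 2" "X 3 3 1 2 = X 1 2 3 3" 
    "X 1 3 1 2 = X 1 2 1 3" "X 2 3 1 2 = X 1 2 2 3" "X 2 3 1 3 = X 1 3 2 3" for k l
    using sym sl by metis+
  have z: "X 1 1 1 1 = 0" "X 2 2 2 2 = 0" "X 3 3 3 3 = 0" 
     "X 1 2 1 1 = 0" "X 1 1 1 2 = 0" "X 1 3 1 1 = 0" "X 1 1 1 3 = 0"
     "X 1 2 2 2 = 0" "X 2 2 1 2 = 0" "X 2 3 2 2 = 0" "X 2 2 2 3 = 0"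
     "X 1 3 3 3 = 0" "X 3 3 1 3 = 0" "X 2 3 3 3 = 0" "X 3 3 2 3 = 0"
    using aaa sym by metis+
  define t where "t = X 1 1 2 2 / (\<xi> $ 3)\<^sup>2"
  define x where "x = \<xi> $ 1"
  define y where "y = \<xi> $ 2"
  define w where "w = \<xi> $ 3"
  have xyz: "x \<noteq> 0" "y \<noteq> 0" "w \<noteq> 0" using \<xi> by (auto simp: x_def y_def w_def)
  have Qx: "?Q = x * x + y * y + w * w" by (simp add: inner_3 x_def y_def w_def)
  have k: "y * X 1 1 2 2 + w * X 2 3 1 1 = 0" "y * X 2 3 1 1 + w * X 1 1 3 3 = 0"
    "x * X 1 1 2 2 + w * X 1 3 2 2 = 0" "x * X 1 3 2 2 + w * X 2 2 3 3 = 0"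
    "x * X 1 1 3 3 + y * X 1 2 3 3 = 0" 
    using ker[of 2 1] ker[of 3 1] ker[of 1 2] ker[of 3 2] ker[of 1 3]
    by (simp_all add: sum_3 nf z x_def y_def w_def)
  have T: "X 1 1 2 2 = t * w * w" "X 2 3 1 1 = - (t * y * w)" "X 1 1 3 3 = t * y * y"
    "X 1 3 2 2 = - (t * x * w)" "X 2 2 3 3 = t * x * x" "X 1 2 3 3 = - (t * x * y)"
  proof -
    show 1: "X 1 1 2 2 = t * w * w" using xyz by (simp add: t_def w_def power2_eq_square)
    have "w * X 2 3 1 1 = w * (- (t * y * w))" using k(1) 1 by (simp add: algebra_simps)
    then show 2: "X 2 3 1 1 = - (t * y * w)" using xyz mult_left_cancel by blast
    have "w * X 1 1 3 3 = w * (t * y * y)" using k(2) 2 by (simp add: algebra_simps)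
    then show 3: "X 1 1 3 3 = t * y * y" using xyz mult_left_cancel by blast
    have "w * X 1 3 2 2 = w * (- (t * x * w))" using k(3) 1 by (simp add: algebra_simps)
    then show 4: "X 1 3 2 2 = - (t * x * w)" using xyz mult_left_cancel by blast
    have "w * X 2 2 3 3 = w * (t * x * x)" using k(4) 4 by (simp add: algebra_simps)
    then show 5: "X 2 2 3 3 = t * x * x" using xyz mult_left_cancel by blast
    have "y * X 1 2 3 3 = y * (- (t * x * y))" using k(5) 3 by (simp add: algebra_simps)
    then show "X 1 2 3 3 = - (t * x * y)" using xyz mult_left_cancel by blast
  qed
  \<comment> \<open>twice the off-diagonal components of \<open>X - t C\<^sub>0\<close>, where \<open>2 C\<^sub>0\<close> is the tensor behind \<open>incomp_minor\<close>\<close>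
  define E :: "real^3^3" where "E = (\<chi> c d. 2 * X (c + 1) (c + 2) (d + 1) (d + 2)) - t *\<^sub>R incomp_minor \<xi>"
  have Es: "transpose E = E"
    unfolding E_def transpose_def incomp_minor_def
    by (simp add: vec_eq_iff forall_3 index3_arith nf)
  \<comment> \<open>scaling by \<open>|\<xi>|\<^sup>2\<close> makes all identities below polynomial in \<open>\<xi>\<close>\<close>
  define R where "R p = ?Q *\<^sub>R reflect \<xi> (axis p 1)" for p
  have R: "R p $ i = ?Q * (if i = p then 1 else 0) - 2 * \<xi> $ p * \<xi> $ i" for p i
  proof -
    have "axis p 1 \<bullet> \<xi> = \<xi> $ p" "(axis p 1 :: real^3) $ i = (if i = p then 1 else 0)"
      by (simp add: inner_axis') (simp add: axis_def)
    then show ?thesis using Q by (simp add: R_def reflect_def algebra_simps)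
  qed
  have SR: "contract X (R p) (R q) a b = 0" if "p \<noteq> q" "a \<noteq> b" for p q a b
  proof -
    have "contract X (R p) (R q) a b = ?Q * contract X (reflect \<xi> (axis p 1)) (R q) a b"
      by (simp add: R_def contract_scale)
    also have "contract X (reflect \<xi> (axis p 1)) (R q) a b = contract X (R q) (reflect \<xi> (axis p 1)) a b"
      by (rule contract_commute[OF sym(1)])
    also have "\<dots> = ?Q * contract X (reflect \<xi> (axis q 1)) (reflect \<xi> (axis p 1)) a b"
      by (simp add: R_def contract_scale)
    finally show ?thesis using SS that by simp
  qed
  \<comment> \<open>the reflection multiplies the tensor \<open>C\<^sub>0\<close> by \<open>|\<xi>|\<^sup>4\<close>, which gives the second summand\<close>
  have eq: "(reflect_minor \<xi> ** E) $ c $ d + t * ?Q\<^sup>2 * incomp_minor \<xi> $ c $ d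
      = 2 * contract X (R (c + 1)) (R (c + 2)) (d + 1) (d + 2)" for c d
  proof -
    have id: "\<forall>c d. (reflect_minor \<xi> ** E) $ c $ d + t * ?Q\<^sup>2 * incomp_minor \<xi> $ c $ d
      = 2 * contract X (R (c + 1)) (R (c + 2)) (d + 1) (d + 2)"
      unfolding forall_3 E_def reflect_minor_def incomp_minor_def contract_def R Let_def Qx
        matrix_matrix_mult_def vec_lambda_beta sum_3 index3_arith vector_minus_component vector_scaleR_component
        x_def[symmetric] y_def[symmetric] w_def[symmetric] nf z T
      by ((simp only: index3_neq if_True if_False refl mult_1_right mult_zero_right diff_zero real_scaleR_def x_def[symmetric] y_def[symmetric] w_def[symmetric]),
          (intro conjI; algebra))
    show ?thesis using id by blast
  qed
  have ME: "reflect_minor \<xi> ** E = (- (t * ?Q\<^sup>2)) *\<^sub>R incomp_minor \<xi>"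
  proof -
    have "c + 1 \<noteq> c + 2" for c :: 3 by simp
    then have "(reflect_minor \<xi> ** E) $ c $ d = - (t * ?Q\<^sup>2) * incomp_minor \<xi> $ c $ d" for c d
      using eq[of c d] SR[of "c + 1" "c + 2" "d + 1" "d + 2"] by simp
    then show ?thesis by (simp add: vec_eq_iff)
  qed
  have "transpose (reflect_minor \<xi>) = reflect_minor \<xi>" "transpose (incomp_minor \<xi>) = incomp_minor \<xi>"
    by (auto simp: transpose_def reflect_minor_def incomp_minor_def vec_eq_iff mult_ac)
  moreover have "reflect_minor \<xi> ** incomp_minor \<xi> \<noteq> incomp_minor \<xi> ** reflect_minor \<xi>"
    "det (reflect_minor \<xi>) \<noteq> 0"
    using gen by (auto simp: generic_direction_def)
  ultimately have "- (t * ?Q\<^sup>2) = 0" and "E = 0"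
    using commuting_minor_rigidity[OF _ Es _ ME] by blast+
  then have t: "t = 0" using Q by simp
  have E0: "X (c + 1) (c + 2) (d + 1) (d + 2) = 0" for c d
    using \<open>E = 0\<close> by (simp add: E_def t vec_eq_iff)
  have e: "X 2 3 2 3 = 0" "X 1 3 1 3 = 0" "X 1 2 1 2 = 0" "X 1 3 2 3 = 0" "X 1 2 2 3 = 0" "X 1 2 1 3 = 0"
    using E0[of 1 1] E0[of 2 2] E0[of 3 3] E0[of 2 1] E0[of 3 1] E0[of 3 2]
    by (simp_all add: index3_arith nf)
  have "\<forall>i j k l. X i j k l = 0"
    by (simp add: forall_3 nf z T t e)
  then show ?thesis by blast
qed

section \<open>Recovery of the medium\<close>

text \<open>The choices of \<open>\<kappa>\<close> come from solving \<open>s \<xi> = \<kappa> ((c' / c) e\<^sub>a - \<omega>)\<close> for a unit vector \<open>\<omega>\<close>. Without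
mode conversion the only solution with \<open>\<omega> \<noteq> e\<^sub>a\<close> is the reflection of \<open>e\<^sub>a\<close>; with conversion, \<open>\<kappa> = s / y\<close> for the roots
\<open>y\<close> of the quadratic equation in \<open>p_wave_kernel\<close>.\<close>

lemma laplace_coefficients_vanish:
  fixes X :: "3 \<Rightarrow> 3 \<Rightarrow> 3 \<Rightarrow> 3 \<Rightarrow> real"
  assumes mu: "mu > 0" "3 * lam + 2 * mu > 0"
    and sym: "\<And>i j k l. X i j k l = X j i k l" "\<And>i j k l. X i j k l = X k l i j"
    and gen: "generic_direction (c_s mu / c_p lam mu) \<xi>" and s: "s > 0"
    and H: "\<And>a b c' \<omega> \<beta> \<kappa>. c' > 0 \<Longrightarrow> admissible lam mu c' \<omega> \<beta> \<Longrightarrow> \<kappa> \<noteq> 0 \<Longrightarrow>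
       s *\<^sub>R \<xi> = \<kappa> *\<^sub>R ((c' / wave_speed lam mu a b) *\<^sub>R axis a 1 - \<omega>) \<Longrightarrow>
       contract X \<beta> \<omega> a b = wave_speed lam mu a b * c' * \<beta> $ b * R"
  shows "R = 0" "X i j k l = 0"
proof -
  let ?cp = "c_p lam mu" and ?cs = "c_s mu"
  define r where "r = ?cs / ?cp"
  have cs: "?cs > 0" using mu by (simp add: c_s_def)
  have cp: "?cp > 0" using mu by (simp add: c_p_def)
  have r: "0 < r" "r < 1"
    using mu cs cp by (simp_all add: r_def c_s_def c_p_def)
  have \<xi>: "\<xi> $ a \<noteq> 0" for a using gen by (simp add: generic_direction_def)
  have \<xi>0: "\<xi> \<noteq> 0" using \<xi>[of 1] by auto
  let ?Q = "\<xi> \<bullet> \<xi>"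
  have Q: "?Q > 0" using \<xi>0 by simp
  have refl: "reflect \<xi> (axis a 1) = axis a 1 - (2 * \<xi> $ a / ?Q) *\<^sub>R \<xi>" for a
    by (simp add: reflect_def inner_axis')
  have ax: "(axis a 1 :: real^3) \<bullet> axis b 1 = (if a = b then 1 else 0)" for a b
    by (simp add: inner_axis_axis)
  have norm_refl: "norm (reflect \<xi> (axis a 1)) = 1" for a
    using reflect_orthogonal[OF \<xi>0, of "axis a 1" "axis a 1"] by (simp add: norm_eq_1 ax)
  have step: "s *\<^sub>R \<xi> = (s * ?Q / (2 * \<xi> $ a)) *\<^sub>R (1 *\<^sub>R axis a 1 - reflect \<xi> (axis a 1))" for a
    using \<xi>[of a] Q by (simp add: refl)
  have kne: "s * ?Q / (2 * \<xi> $ a) \<noteq> 0" for a using s Q \<xi>[of a] by simp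
  have SS: "contract X \<beta> (reflect \<xi> (axis a 1)) a b = ?cs * ?cs * \<beta> $ b * R"
    if "a \<noteq> b" "\<beta> \<bullet> reflect \<xi> (axis a 1) = 0" for a b \<beta>
    using H[OF cs _ kne, of "reflect \<xi> (axis a 1)" \<beta> a a b] step[of a] that cs norm_refl
    by (simp add: admissible_def wave_speed_def)
  have PP: "contract X (reflect \<xi> (axis a 1)) (reflect \<xi> (axis a 1)) a a
      = ?cp * ?cp * reflect \<xi> (axis a 1) $ a * R" for a
    using H[OF cp _ kne, of "reflect \<xi> (axis a 1)" "reflect \<xi> (axis a 1)" a a a] step[of a] cp norm_refl
    by (simp add: admissible_def wave_speed_def)
  have ort: "reflect \<xi> (axis p 1) \<bullet> reflect \<xi> (axis q 1) = 0" if "p \<noteq> q" for p q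
    using reflect_orthogonal[OF \<xi>0] that by (simp add: ax)
  have commute: "contract X v w a b = contract X w v a b" for v w a b
    by (rule contract_commute) (rule sym)
  have swap: "contract X v w a b = contract X v w b a" for v w a b
  proof -
    have "X i j a b = X i j b a" for i j using sym by metis
    then show ?thesis by (simp add: contract_def)
  qed
  \<comment> \<open>exchanging the direction and the polarization of the incident S-wave leaves the left-hand side unchanged\<close>
  have "?cs * ?cs * reflect \<xi> (axis 2 1) $ 2 * R
      = contract X (reflect \<xi> (axis 2 1)) (reflect \<xi> (axis 1 1)) 1 2"
    using SS[of 1 2 "reflect \<xi> (axis 2 1)"] ort[of 2 1] by simp
  also have "\<dots> = contract X (reflect \<xi> (axis 1 1)) (reflect \<xi> (axis 2 1)) 1 2"
    by (rule commute)
  also have "\<dots> = contract X (reflect \<xi> (axis 1 1)) (reflect \<xi> (axis 2 1)) 2 1"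
    by (rule swap)
  also have "\<dots> = ?cs * ?cs * reflect \<xi> (axis 1 1) $ 1 * R"
    using SS[of 2 1 "reflect \<xi> (axis 1 1)"] ort[of 1 2] by simp
  finally have "?cs * ?cs * reflect \<xi> (axis 2 1) $ 2 * R = ?cs * ?cs * reflect \<xi> (axis 1 1) $ 1 * R" .
  moreover have "reflect \<xi> (axis a 1) $ a = 1 - 2 * (\<xi> $ a)\<^sup>2 / ?Q" for a
    unfolding refl by (simp add: axis_def power2_eq_square)
  ultimately have "((\<xi> $ 1)\<^sup>2 - (\<xi> $ 2)\<^sup>2) * R = 0"
    using cs Q by (simp add: field_simps)
  then show R: "R = 0" using gen by (simp add: generic_direction_def)
  have PS: "contract X \<beta> (r *\<^sub>R axis a 1 - y *\<^sub>R \<xi>) a a = 0"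
    if y: "?Q * y\<^sup>2 - 2 * r * \<xi> $ a * y = 1 - r\<^sup>2" and \<beta>: "\<beta> \<bullet> (r *\<^sub>R axis a 1 - y *\<^sub>R \<xi>) = 0" for a y \<beta>
  proof -
    let ?w = "r *\<^sub>R axis a 1 - y *\<^sub>R \<xi>"
    have "1 - r\<^sup>2 > 0" using r by (simp add: power_less_one_iff abs_square_less_1)
    then have y0: "y \<noteq> 0" using y by auto
    have "?w \<bullet> ?w = 1"
      using y by (simp add: inner_diff_left inner_diff_right inner_axis inner_axis' algebra_simps power2_eq_square)
    then have "admissible lam mu ?cs ?w \<beta>" using \<beta> by (simp add: admissible_def norm_eq_1)
    moreover have "s *\<^sub>R \<xi> = (s / y) *\<^sub>R ((?cs / wave_speed lam mu a a) *\<^sub>R axis a 1 - ?w)"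
      using y0 by (simp add: wave_speed_def r_def)
    ultimately show ?thesis using H[OF cs, of ?w \<beta> "s / y" a a] s y0 R by simp
  qed
  have SS0: "contract X (reflect \<xi> (axis p 1)) (reflect \<xi> (axis q 1)) a b = 0" if "a \<noteq> b" "p \<noteq> q" for a b p q
  proof -
    have q: "contract X (reflect \<xi> (axis p 1)) (reflect \<xi> (axis q 1)) q b = 0" if "q \<noteq> b" "p \<noteq> q" for p q b
      using SS[of q b "reflect \<xi> (axis p 1)"] ort[of p q] that R by simp
    \<comment> \<open>two pairs of indices in a set of three elements meet, so each equation is an S to S experiment up to symmetry\<close>
    have "q = a \<or> q = b \<or> p = a \<or> p = b"
      using that exhaust_3[of a] exhaust_3[of b] exhaust_3[of p] exhaust_3[of q] by auto
    then show ?thesis using q that commute swap by metis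
  qed
  show "X i j k l = 0"
    by (rule tensor_rigidity[OF sym r gen[folded r_def] _ PS SS0]) (use PP R in auto)
qed

theorem theorem1p1:
  fixes lam mu :: real
  assumes "mu > 0" and "3 * lam + 2 * mu > 0"
  shows "\<exists>T\<^sub>0>0. \<forall>T\<ge>T\<^sub>0.
    \<forall>(\<rho> :: real^3 \<Rightarrow> real) (C :: 3 \<Rightarrow> 3 \<Rightarrow> 3 \<Rightarrow> 3 \<Rightarrow> real^3 \<Rightarrow> real)
     (u :: 3 \<Rightarrow> 3 \<Rightarrow> 3 \<Rightarrow> spacetime functional).
      \<rho> \<in> Cc_inf (ball 0 1) \<longrightarrow>
      (\<forall>i j k l. C i j k l \<in> Cc_inf (ball 0 1)) \<longrightarrow>
      (\<forall>i j k l. C i j k l = C j i k l \<and> C i j k l = C k l i j) \<longrightarrow>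
      (\<forall>i j. linearized_scattered_wave lam mu C \<rho> (axis i 1) (axis j 1) (u i j)) \<longrightarrow>
      (\<forall>i j m. vanishes_on (u i j m) ((- ball 0 1) \<times> {..T})) \<longrightarrow>
      (\<forall>x. \<rho> x = 0) \<and> (\<forall>i j k l x. C i j k l x = 0)"
proof -
  let ?cp = "c_p lam mu" and ?cs = "c_s mu"
  have pos: "lam + 2 * mu > 0" using assms by linarith
  have cs: "?cs > 0" using assms by (simp add: c_s_def)
  have cp: "?cs < ?cp" using assms by (simp add: c_p_def c_s_def)
  define r where "r = ?cs / ?cp"
  \<comment> \<open>the bound on \<open>r\<^sup>2\<close> is where \<open>3 lam + 2 mu > 0\<close> is used in full\<close>
  have "r\<^sup>2 = mu / (lam + 2 * mu)"
    using assms pos by (simp add: r_def c_s_def c_p_def power_divide)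
  moreover have "mu / (lam + 2 * mu) < 3 / 4" using assms pos by (simp add: divide_simps)
  ultimately have r: "0 < r" "r\<^sup>2 < 3 / 4" using cs cp by (simp_all add: r_def)
  obtain \<xi>0 where "generic_direction r \<xi>0" using generic_direction_exists[OF r] by blast
  then have "\<xi>0 \<in> {\<xi>. generic_direction r \<xi>}" by simp
  then obtain e where e: "e > 0" "ball \<xi>0 e \<subseteq> {\<xi>. generic_direction r \<xi>}"
    by (rule openE[OF generic_direction_open])
  then have generic: "generic_direction r \<xi>" if "\<xi> \<in> ball \<xi>0 e" for \<xi>
    using that by (auto dest: subsetD)
  define K where "K = (\<Union>s\<in>{0<..}. (*\<^sub>R) s ` ball \<xi>0 e)"
  have K: "open K" "\<And>\<xi> \<eta>. \<xi> \<in> K \<Longrightarrow> \<eta> \<in> K \<Longrightarrow> \<xi> + \<eta> \<in> K"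
    unfolding K_def by (fact open_cone_over_ball)+
  have "1 *\<^sub>R \<xi>0 \<in> K" unfolding K_def using e(1) by (intro UN_I[of 1] imageI) auto
  then have K0: "K \<noteq> {}" by blast
  \<comment> \<open>bounds the phase on the front for every combination of incident and outgoing wave\<close>
  define L where "L = ?cp / ?cs + 1"
  have L0: "L > 0" using cs cp by (simp add: L_def add_pos_pos)
  have speed: "c = ?cp \<or> c = ?cs" if "c = wave_speed lam mu a b" for c a b
    using that by (simp add: wave_speed_def split: if_splits)
  have ratio: "c' / c + 1 \<le> L" if "c' = ?cp \<or> c' = ?cs" "c = ?cp \<or> c = ?cs" for c c'
  proof -
    have "c' \<le> ?cp" "?cs \<le> c" "c' \<ge> 0" using that cs cp by auto
    then show ?thesis using cs by (simp add: L_def frac_le)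
  qed
  show ?thesis
  proof (intro exI[of _ "(L + 3) / ?cs"] conjI allI impI)
    show "(L + 3) / ?cs > 0" using L0 cs by simp
    fix T \<rho> and C :: "3 \<Rightarrow> 3 \<Rightarrow> 3 \<Rightarrow> 3 \<Rightarrow> real^3 \<Rightarrow> real" and u :: "3 \<Rightarrow> 3 \<Rightarrow> 3 \<Rightarrow> spacetime functional"
    assume T: "(L + 3) / ?cs \<le> T" and \<rho>: "\<rho> \<in> Cc_inf (ball 0 1)"
      and C: "\<forall>i j k l. C i j k l \<in> Cc_inf (ball 0 1)"
      and sym: "\<forall>i j k l. C i j k l = C j i k l \<and> C i j k l = C k l i j"
      and u: "\<forall>i j. linearized_scattered_wave lam mu C \<rho> (axis i 1) (axis j 1) (u i j)"
      and van: "\<forall>i j m. vanishes_on (u i j m) ((- ball 0 1) \<times> {..T})"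
    have vanish: "laplace \<rho> \<eta> = 0 \<and> laplace (C i j k l) \<eta> = 0" if \<eta>: "\<eta> \<in> K" for \<eta> i j k l
    proof -
      obtain s \<xi> where s: "s > 0" "\<xi> \<in> ball \<xi>0 e" "\<eta> = s *\<^sub>R \<xi>" using \<eta> by (auto simp: K_def)
      have id: "contract (\<lambda>i j k l. laplace (C i j k l) \<eta>) \<beta> \<omega> a b
          = wave_speed lam mu a b * c' * \<beta> $ b * laplace \<rho> \<eta>"
        if "c' > 0" "admissible lam mu c' \<omega> \<beta>" "\<kappa> \<noteq> 0"
          "s *\<^sub>R \<xi> = \<kappa> *\<^sub>R ((c' / wave_speed lam mu a b) *\<^sub>R axis a 1 - \<omega>)" for a b c' \<omega> \<beta> \<kappa>
      proof (rule scattering_identity[OF assms(1) pos \<rho> _ _ _ that(1,2) _ _ that(3)])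
        have c': "c' = ?cp \<or> c' = ?cs" using that(2) by (auto simp: admissible_def)
        show "c' / wave_speed lam mu a b + 1 \<le> L" by (rule ratio[OF c' speed[OF refl]])
        have "(L + 3) / c' \<le> (L + 3) / ?cs" using c' cs cp L0 by (intro divide_left_mono) auto
        then show "(L + 3) / c' \<le> T" using T by linarith
      qed (use C u van s that(4) in auto)
      have sym': "laplace (C i j k l) \<eta> = laplace (C j i k l) \<eta>" "laplace (C i j k l) \<eta> = laplace (C k l i j) \<eta>" for i j k l
        using sym by metis+
      note rigidity = laplace_coefficients_vanish[where X="\<lambda>i j k l. laplace (C i j k l) \<eta>" and R="laplace \<rho> \<eta>",
          OF assms sym' generic[OF s(2), unfolded r_def] s(1)]
      have "laplace \<rho> \<eta> = 0" by (rule rigidity(1)) (rule id)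
      moreover have "laplace (C i j k l) \<eta> = 0" by (rule rigidity(2)) (rule id)
      ultimately show ?thesis ..
    qed
    have inj: "f x = 0" if "f \<in> Cc_inf (ball 0 1)" "\<And>\<eta>. \<eta> \<in> K \<Longrightarrow> laplace f \<eta> = 0" for f x
    proof (rule laplace_transform_injective[OF _ compact_cball _ K(1) K0 K(2)])
      show "continuous_on UNIV f" using that(1) smooth_continuous by (auto simp: Cc_inf_def)
      show "f x = 0" if "x \<notin> cball 0 1" for x
        using that \<open>f \<in> Cc_inf (ball 0 1)\<close> by (intro Cc_inf_ball_zero) auto
    qed (use that(2) in \<open>auto simp: laplace_def\<close>)
    show "\<rho> x = 0" for x using inj[OF \<rho>] vanish by blast
    show "C i j k l x = 0" for i j k l x using inj[of "C i j k l"] C vanish by blast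
  qed
qed

end
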